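(* Let $K$ be an infinite field of characteristic $p>0$ definable in a structure whose complete theory is $\mathrm{NTP}_2$. Then $K$ has only finitely many Artin–Schreier extensions.
   Context: For a field $K$ of characteristic $p>0$, a field extension $L/K$ is an Artin–Schreier extension if $L=K(\alpha)$ for some $\alpha\in L\setminus K$ with $\alpha^p-\alpha\in K$ (equivalently, $L/K$ is Galois and cyclic of degree $p$). A formula $\varphi(x,y)$ has $\mathrm{TP}_2$ if there are tuples $(a_{i,j})_{i,j\in\omega}$ and $k\in\omega$ such that for each $i$ the set $\{\varphi(x,a_{i,j}) : j<\omega\}$ is $k$-inconsistent, and for every $f:\omega\to\omega$ the set $\{\varphi(x,a_{i,f(i)}) : i<\omega\}$ is consistent; a theory is $\mathrm{NTP}_2$ if no formula has $\mathrm{TP}_2$. Definable means definable with parameters (the field may live in a finite Cartesian power of the structure). *)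

theory Defs
  imports "HOL-Algebra.Generated_Fields" "HOL-Algebra.Algebraic_Closure"
begin

section \<open>First-order logic\<close>

text \<open>
  A language is a set of function symbols and a set of relation symbols, each symbol paired with
  its arity; either set may be empty, and nothing bounds their cardinality. Constants are function
  symbols of arity 0.
\<close>

record ('f, 'r) lang =
  funs :: "('f \<times> nat) set"
  rels :: "('r \<times> nat) set"

datatype 'f trm = Var nat | Fn 'f "'f trm list"

datatype ('f, 'r) fm =
    Equal "'f trm" "'f trm"
  | Rel 'r "'f trm list"
  | Neg "('f, 'r) fm"
  | Conj "('f, 'r) fm" "('f, 'r) fm"
  | Exi nat "('f, 'r) fm"

fun wf_trm :: "('f, 'r) lang \<Rightarrow> 'f trm \<Rightarrow> bool" where
  "wf_trm L (Var i) = True"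
| "wf_trm L (Fn f ts) = ((f, length ts) \<in> funs L \<and> (\<forall>t \<in> set ts. wf_trm L t))"

fun wf_fm :: "('f, 'r) lang \<Rightarrow> ('f, 'r) fm \<Rightarrow> bool" where
  "wf_fm L (Equal s t) = (wf_trm L s \<and> wf_trm L t)"
| "wf_fm L (Rel r ts) = ((r, length ts) \<in> rels L \<and> (\<forall>t \<in> set ts. wf_trm L t))"
| "wf_fm L (Neg \<phi>) = wf_fm L \<phi>"
| "wf_fm L (Conj \<phi> \<psi>) = (wf_fm L \<phi> \<and> wf_fm L \<psi>)"
| "wf_fm L (Exi i \<phi>) = wf_fm L \<phi>"

fun fv_trm :: "'f trm \<Rightarrow> nat set" where
  "fv_trm (Var i) = {i}"
| "fv_trm (Fn f ts) = (\<Union>t \<in> set ts. fv_trm t)"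

fun fv :: "('f, 'r) fm \<Rightarrow> nat set" where
  "fv (Equal s t) = fv_trm s \<union> fv_trm t"
| "fv (Rel r ts) = (\<Union>t \<in> set ts. fv_trm t)"
| "fv (Neg \<phi>) = fv \<phi>"
| "fv (Conj \<phi> \<psi>) = fv \<phi> \<union> fv \<psi>"
| "fv (Exi i \<phi>) = fv \<phi> - {i}"

record ('f, 'r, 'u) struct =
  univ :: "'u set"
  fint :: "'f \<Rightarrow> 'u list \<Rightarrow> 'u"
  rint :: "'r \<Rightarrow> 'u list \<Rightarrow> bool"

definition is_struct :: "('f, 'r) lang \<Rightarrow> ('f, 'r, 'u) struct \<Rightarrow> bool" where
  "is_struct L M \<longleftrightarrow> univ M \<noteq> {} \<and>
     (\<forall>(f, n) \<in> funs L. \<forall>us. length us = n \<and> set us \<subseteq> univ M \<longrightarrow> fint M f us \<in> univ M)"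

fun tval :: "('f, 'r, 'u) struct \<Rightarrow> (nat \<Rightarrow> 'u) \<Rightarrow> 'f trm \<Rightarrow> 'u" where
  "tval M s (Var i) = s i"
| "tval M s (Fn f ts) = fint M f (map (tval M s) ts)"

fun sat :: "('f, 'r, 'u) struct \<Rightarrow> (nat \<Rightarrow> 'u) \<Rightarrow> ('f, 'r) fm \<Rightarrow> bool" where
  "sat M s (Equal t u) = (tval M s t = tval M s u)"
| "sat M s (Rel r ts) = rint M r (map (tval M s) ts)"
| "sat M s (Neg \<phi>) = (\<not> sat M s \<phi>)"
| "sat M s (Conj \<phi> \<psi>) = (sat M s \<phi> \<and> sat M s \<psi>)"
| "sat M s (Exi i \<phi>) = (\<exists>u \<in> univ M. sat M (s(i := u)) \<phi>)"

definition tuples :: "('f, 'r, 'u) struct \<Rightarrow> nat \<Rightarrow> 'u list set" where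
  "tuples M n = {us. length us = n \<and> set us \<subseteq> univ M}"

text \<open>
  \<open>sat_tup M \<phi> us\<close> evaluates \<open>\<phi>\<close> with the variables \<open>0, 1, \<dots>\<close> standing for the entries of \<open>us\<close>.
  It is only used when \<open>fv \<phi> \<subseteq> {..<length us}\<close>, so that values beyond the end of the list are
  irrelevant.
\<close>

definition sat_tup :: "('f, 'r, 'u) struct \<Rightarrow> ('f, 'r) fm \<Rightarrow> 'u list \<Rightarrow> bool" where
  "sat_tup M \<phi> us \<longleftrightarrow> sat M (\<lambda>i. us ! i) \<phi>"

definition sentences :: "('f, 'r) lang \<Rightarrow> ('f, 'r) fm set" where
  "sentences L = {\<phi>. wf_fm L \<phi> \<and> fv \<phi> = {}}"

definition complete_theory :: "('f, 'r) lang \<Rightarrow> ('f, 'r, 'u) struct \<Rightarrow> ('f, 'r) fm set" where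
  "complete_theory L M = {\<phi> \<in> sentences L. sat_tup M \<phi> []}"

definition is_model :: "('f, 'r) lang \<Rightarrow> ('f, 'r) fm set \<Rightarrow> ('f, 'r, 'u) struct \<Rightarrow> bool" where
  "is_model L T M \<longleftrightarrow> is_struct L M \<and> (\<forall>\<phi> \<in> T. sat_tup M \<phi> [])"

definition elementary_embedding ::
    "('f, 'r) lang \<Rightarrow> ('f, 'r, 'u) struct \<Rightarrow> ('f, 'r, 'v) struct \<Rightarrow> ('u \<Rightarrow> 'v) \<Rightarrow> bool" where
  "elementary_embedding L M N e \<longleftrightarrow> e ` univ M \<subseteq> univ N \<and>
     (\<forall>\<phi> us. wf_fm L \<phi> \<and> set us \<subseteq> univ M \<and> fv \<phi> \<subseteq> {..<length us} \<longrightarrow>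
        (sat_tup M \<phi> us \<longleftrightarrow> sat_tup N \<phi> (map e us)))"


section \<open>NTP2\<close>

text \<open>
  HOL cannot quantify over models of arbitrary size, so the models below live on the type of
  formulas, which has cardinality max(|L|, aleph 0) or more. This loses nothing: by downward
  Loewenheim-Skolem, a countable array of parameters from any model of \<open>T\<close> lies in an elementary
  submodel whose cardinality is at most max(|L|, aleph 0), and a countable set of formulas over it
  realised in some elementary extension is realised in one that is no larger.
\<close>

type_synonym ('f, 'r) small_struct = "('f, 'r, ('f, 'r) fm) struct"

text \<open>
  In \<open>\<phi>(x, y)\<close> the tuple \<open>x\<close> consists of the variables \<open>0, \<dots>, m - 1\<close> and \<open>y\<close> of the next ones. For a set
  \<open>A\<close> of tuples of \<open>N\<close>, \<open>consistent L N \<phi> m A\<close> says that \<open>{\<phi>(x, a) : a \<in> A}\<close> is consistent (with the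
  elementary diagram of \<open>N\<close>): it has a realisation in some elementary extension of \<open>N\<close>.
\<close>

definition consistent :: "('f, 'r) lang \<Rightarrow> ('f, 'r) small_struct \<Rightarrow> ('f, 'r) fm \<Rightarrow> nat
    \<Rightarrow> ('f, 'r) fm list set \<Rightarrow> bool" where
  "consistent L N \<phi> m A \<longleftrightarrow>
     (\<exists>(N' :: ('f, 'r) small_struct) e. is_struct L N' \<and> elementary_embedding L N N' e \<and>
        (\<exists>b \<in> tuples N' m. \<forall>a \<in> A. sat_tup N' \<phi> (b @ map e a)))"

text \<open>
  A row \<open>{\<phi>(x, a i j) : j < \<omega>}\<close> is k-inconsistent as a family indexed by \<open>j\<close>: the instances at any \<open>k\<close>
  distinct indices are inconsistent. Read as a mere set of formulas, a constant row would be
  vacuously 2-inconsistent.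
\<close>

definition has_TP2 :: "('f, 'r) lang \<Rightarrow> ('f, 'r) fm set \<Rightarrow> ('f, 'r) fm \<Rightarrow> nat \<Rightarrow> nat \<Rightarrow> bool" where
  "has_TP2 L T \<phi> m n \<longleftrightarrow>
     (\<exists>(N :: ('f, 'r) small_struct) (a :: nat \<Rightarrow> nat \<Rightarrow> ('f, 'r) fm list) (k :: nat).
        is_model L T N \<and> (\<forall>i j. a i j \<in> tuples N n) \<and>
        (\<forall>i J. finite J \<and> card J = k \<longrightarrow> \<not> consistent L N \<phi> m (a i ` J)) \<and>
        (\<forall>f :: nat \<Rightarrow> nat. consistent L N \<phi> m (range (\<lambda>i. a i (f i)))))"

definition NTP2 :: "('f, 'r) lang \<Rightarrow> ('f, 'r) fm set \<Rightarrow> bool" where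
  "NTP2 L T \<longleftrightarrow>
     (\<forall>\<phi> m n. wf_fm L \<phi> \<and> fv \<phi> \<subseteq> {..<m + n} \<longrightarrow> \<not> has_TP2 L T \<phi> m n)"


section \<open>Definable fields\<close>

text \<open>Subsets of the n-th Cartesian power definable with parameters \<open>cs\<close>.\<close>

definition definable_set ::
    "('f, 'r) lang \<Rightarrow> ('f, 'r, 'u) struct \<Rightarrow> nat \<Rightarrow> 'u list set \<Rightarrow> bool" where
  "definable_set L M n S \<longleftrightarrow>
     (\<exists>\<phi> cs. wf_fm L \<phi> \<and> set cs \<subseteq> univ M \<and> fv \<phi> \<subseteq> {..<n + length cs} \<and>
        S = {us \<in> tuples M n. sat_tup M \<phi> (us @ cs)})"

definition definable_field ::
    "('f, 'r) lang \<Rightarrow> ('f, 'r, 'u) struct \<Rightarrow> nat \<Rightarrow> 'u list ring \<Rightarrow> bool" where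
  "definable_field L M d K \<longleftrightarrow> field K \<and>
     definable_set L M d (carrier K) \<and>
     definable_set L M (3 * d)
       {x @ y @ (x \<oplus>\<^bsub>K\<^esub> y) | x y. x \<in> carrier K \<and> y \<in> carrier K} \<and>
     definable_set L M (3 * d)
       {x @ y @ (x \<otimes>\<^bsub>K\<^esub> y) | x y. x \<in> carrier K \<and> y \<in> carrier K}"


section \<open>Artin--Schreier extensions\<close>

definition has_characteristic :: "('a, 'b) ring_scheme \<Rightarrow> nat \<Rightarrow> bool" where
  "has_characteristic R p \<longleftrightarrow> (\<forall>n :: nat. [n] \<cdot>\<^bsub>R\<^esub> \<one>\<^bsub>R\<^esub> = \<zero>\<^bsub>R\<^esub> \<longleftrightarrow> p dvd n)"

text \<open>\<open>F\<close> is an Artin--Schreier extension of \<open>k\<close>, both being subfields of \<open>\<Omega>\<close>.\<close>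

definition artin_schreier_extension ::
    "nat \<Rightarrow> ('a, 'b) ring_scheme \<Rightarrow> 'a set \<Rightarrow> 'a set \<Rightarrow> bool" where
  "artin_schreier_extension p \<Omega> k F \<longleftrightarrow>
     subfield k \<Omega> \<and> subfield F \<Omega> \<and> k \<subseteq> F \<and>
     (\<exists>\<alpha> \<in> F - k. (\<alpha> [^]\<^bsub>\<Omega>\<^esub> p) \<ominus>\<^bsub>\<Omega>\<^esub> \<alpha> \<in> k \<and> F = generate_field \<Omega> (insert \<alpha> k))"

end

theory Submission
  imports Defs "HOL-Computational_Algebra.Primes"
begin

text \<open>
  The argument goes back to Chernikov, Kaplan and Simon. Write \<open>\<wp>(x) = x\<^sup>p - x\<close> and
  \<open>H\<^sub>w = {t. w t \<in> \<wp>(K)}\<close>. Infinitely many Artin--Schreier extensions make \<open>K / \<wp>(K)\<close> infinite, because the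
  coset of \<open>\<alpha>\<^sup>p - \<alpha>\<close> determines \<open>K(\<alpha>)\<close>. If \<open>w\<^sub>1, \<dots>, w\<^sub>n\<close> are such that, for each \<open>i\<close>, the
  intersection of the other groups meets infinitely many cosets of \<open>H\<^bsub>w\<^sub>i\<^esub>\<close>, then these cosets form
  a TP2 pattern with \<open>n\<close> rows, and patterns for all \<open>n\<close> combine to TP2 in an ultrapower.

  To find the \<open>w\<^sub>i\<close>, one parametrises an intersection \<open>S\<close> of groups \<open>H\<^sub>w\<close> by an additive map
  \<open>f : K \<rightarrow> S\<close> and computes its adjoint for the pairing \<open>(w, t) \<mapsto> w t + \<wp>(K)\<close>, that is, a map \<open>d\<close>
  with \<open>w f(y) = d(w) y\<close> modulo \<open>\<wp>(K)\<close>; it exists on scalars \<open>w\<close> that are iterated \<open>p\<close>-th powers. If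
  \<open>d(w) \<noteq> 0\<close> then \<open>S / (S \<inter> H\<^sub>w)\<close> is isomorphic to \<open>K / \<wp>(K)\<close>, hence infinite, and \<open>d(w) = 0\<close> has
  only finitely many solutions, so that enough independent scalars exist in an infinite field.
\<close>

section \<open>Variables and renaming\<close>

text \<open>The pairing is bilinear only over the prime field, so linear independence of the scalars
  alone does not show that a further condition \<open>w t\<close> in \<wp>(K) cuts down an
  intersection already formed. Parametrising the intersection by K reduces this to whether the
  single element \<open>d w\<close> vanishes, because a nonzero multiple of \<open>y\<close> runs
  through all of K. Imposing one more condition composes \<open>f\<close> with a multiple of \<wp>,
  and the adjoint of that map needs a p-th root of a scalar. K may be imperfect, so roots are
  budgeted: the scalars come from the p^N-th powers, where N bounds the number of conditions. These
  powers still form an infinite set because the Frobenius map is injective. One formula serves every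
  number of rows, since the scalar is part of the parameter tuple; only this allows the finite
  patterns to be combined. Distinct cosets of a group are disjoint, so rows are 2-inconsistent, a
  property that is first-order in the two parameter tuples.\<close>

lemma tval_cong: "(\<And>i. i \<in> fv_trm t \<Longrightarrow> s i = s' i) \<Longrightarrow> tval M s t = tval M s' t"
  by (induction t) (auto intro!: arg_cong[where f = "fint M _"] map_cong)

lemma sat_cong: "(\<And>i. i \<in> fv \<phi> \<Longrightarrow> s i = s' i) \<Longrightarrow> sat M s \<phi> = sat M s' \<phi>"
proof (induction \<phi> arbitrary: s s')
  case (Equal t u)
  then show ?case using tval_cong[of t s s' M] tval_cong[of u s s' M] by simp
next
  case (Rel r ts)
  then have "map (tval M s) ts = map (tval M s') ts" by (auto intro!: tval_cong)
  then show ?case by (simp only: sat.simps)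
next
  case (Neg \<phi>)
  then show ?case by (metis fv.simps(3) sat.simps(3))
next
  case (Conj \<phi> \<psi>)
  then show ?case by (metis UnCI fv.simps(4) sat.simps(4))
next
  case (Exi i \<phi>)
  have "sat M (s(i := u)) \<phi> = sat M (s'(i := u)) \<phi>" for u
    using Exi.prems by (intro Exi.IH) auto
  then show ?case by simp
qed

lemma finite_fv_trm: "finite (fv_trm t)"
  by (induction t) auto

lemma finite_fv: "finite (fv \<phi>)"
  by (induction \<phi>) (auto simp: finite_fv_trm)

fun rename_trm :: "(nat \<Rightarrow> nat) \<Rightarrow> 'f trm \<Rightarrow> 'f trm" where
  "rename_trm \<rho> (Var i) = Var (\<rho> i)"
| "rename_trm \<rho> (Fn f ts) = Fn f (map (rename_trm \<rho>) ts)"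

text \<open>Each binder receives a variable above all images of the free variables of its body,
  which rules out capture even for a non-injective \<open>\<rho>\<close>. The inserted 0 keeps the
  maximum defined when there are no free variables.\<close>

fun rename :: "(nat \<Rightarrow> nat) \<Rightarrow> ('f, 'r) fm \<Rightarrow> ('f, 'r) fm" where
  "rename \<rho> (Equal t u) = Equal (rename_trm \<rho> t) (rename_trm \<rho> u)"
| "rename \<rho> (Rel r ts) = Rel r (map (rename_trm \<rho>) ts)"
| "rename \<rho> (Neg \<phi>) = Neg (rename \<rho> \<phi>)"
| "rename \<rho> (Conj \<phi> \<psi>) = Conj (rename \<rho> \<phi>) (rename \<rho> \<psi>)"
| "rename \<rho> (Exi i \<phi>) =
     (let j = Suc (Max (insert 0 (\<rho> ` fv \<phi>))) in Exi j (rename (\<rho>(i := j)) \<phi>))"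

lemma wf_rename_trm [simp]: "wf_trm L (rename_trm \<rho> t) = wf_trm L t"
  by (induction t) auto

lemma wf_rename [simp]: "wf_fm L (rename \<rho> \<phi>) = wf_fm L \<phi>"
  by (induction \<phi> arbitrary: \<rho>) (auto simp: Let_def)

lemma fv_rename_trm: "fv_trm (rename_trm \<rho> t) = \<rho> ` fv_trm t"
  by (induction t) auto

lemma fv_rename: "fv (rename \<rho> \<phi>) \<subseteq> \<rho> ` fv \<phi>"
proof (induction \<phi> arbitrary: \<rho>)
  case (Exi i \<phi>)
  show ?case
  proof
    fix v assume v: "v \<in> fv (rename \<rho> (Exi i \<phi>))"
    define j where "j = Suc (Max (insert 0 (\<rho> ` fv \<phi>)))"
    have "v \<in> (\<rho>(i := j)) ` fv \<phi>" "v \<noteq> j"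
      using v subsetD[OF Exi.IH[of "\<rho>(i := j)"]]
      by (simp_all only: rename.simps Let_def j_def[symmetric] fv.simps Diff_iff insert_iff empty_iff)
        blast+
    then show "v \<in> \<rho> ` fv (Exi i \<phi>)" by (auto split: if_splits)
  qed
qed (fastforce simp: fv_rename_trm)+

lemma tval_rename: "tval M s (rename_trm \<rho> t) = tval M (s \<circ> \<rho>) t"
  by (induction t) (auto intro!: arg_cong[where f = "fint M _"])

lemma sat_rename: "sat M s (rename \<rho> \<phi>) = sat M (s \<circ> \<rho>) \<phi>"
proof (induction \<phi> arbitrary: \<rho> s)
  case (Exi i \<phi>)
  define j where "j = Suc (Max (insert 0 (\<rho> ` fv \<phi>)))"
  have j: "\<rho> v \<noteq> j" if "v \<in> fv \<phi>" for v
  proof -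
    have "\<rho> v \<le> Max (insert 0 (\<rho> ` fv \<phi>))" using that finite_fv[of \<phi>] by (intro Max_ge) auto
    then show ?thesis by (simp add: j_def)
  qed
  have "sat M (s(j := u) \<circ> \<rho>(i := j)) \<phi> = sat M ((s \<circ> \<rho>)(i := u)) \<phi>" for u
    by (rule sat_cong) (auto simp: j)
  then show ?case by (simp only: rename.simps Let_def j_def[symmetric] sat.simps Exi.IH)
qed (auto simp: tval_rename comp_def)

lemma sat_tup_append_ignore:
  assumes "fv \<phi> \<subseteq> {..<length us}"
  shows "sat_tup M \<phi> (us @ vs) = sat_tup M \<phi> us"
  unfolding sat_tup_def using assms by (intro sat_cong) (auto simp: nth_append)

lemma sat_tup_rename:
  assumes "\<And>v. v \<in> fv \<phi> \<Longrightarrow> us ! \<rho> v = vs ! v"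
  shows "sat_tup M (rename \<rho> \<phi>) us = sat_tup M \<phi> vs"
  unfolding sat_tup_def sat_rename using assms by (intro sat_cong) simp

section \<open>Existential quantification over tuples\<close>

fun Exis :: "nat \<Rightarrow> nat \<Rightarrow> ('f, 'r) fm \<Rightarrow> ('f, 'r) fm" where
  "Exis i 0 \<phi> = \<phi>"
| "Exis i (Suc k) \<phi> = Exi i (Exis (Suc i) k \<phi>)"

lemma wf_Exis [simp]: "wf_fm L (Exis i k \<phi>) = wf_fm L \<phi>"
  by (induction k arbitrary: i) auto

lemma fv_Exis: "fv (Exis i k \<phi>) = fv \<phi> - {i..<i + k}"
  by (induction k arbitrary: i) auto

text \<open>The bound variable is the first index past the end of the list, so changing the
  assignment there amounts to appending an entry.\<close>

lemma sat_tup_Exi: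
  assumes "fv \<phi> \<subseteq> {..length us}"
  shows "sat_tup M (Exi (length us) \<phi>) us \<longleftrightarrow> (\<exists>u \<in> univ M. sat_tup M \<phi> (us @ [u]))"
proof -
  have "sat M (((!) us)(length us := u)) \<phi> = sat M ((!) (us @ [u])) \<phi>" for u
    using assms by (intro sat_cong) (auto simp: nth_append subset_iff)
  then show ?thesis by (simp add: sat_tup_def)
qed

lemma sat_tup_Exis:
  assumes "fv \<phi> \<subseteq> {..<length us + k}"
  shows "sat_tup M (Exis (length us) k \<phi>) us \<longleftrightarrow> (\<exists>vs \<in> tuples M k. sat_tup M \<phi> (us @ vs))"
  using assms
proof (induction k arbitrary: us)
  case 0
  then show ?case by (simp add: tuples_def)
next
  case (Suc k)
  have "fv (Exis (Suc (length us)) k \<phi>) \<subseteq> {..length us}"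
    using Suc.prems by (auto simp: fv_Exis subset_iff)
  then have "sat_tup M (Exis (length us) (Suc k) \<phi>) us
      \<longleftrightarrow> (\<exists>u \<in> univ M. sat_tup M (Exis (length (us @ [u])) k \<phi>) (us @ [u]))"
    by (simp add: sat_tup_Exi)
  also have "\<dots> \<longleftrightarrow> (\<exists>u \<in> univ M. \<exists>vs \<in> tuples M k. sat_tup M \<phi> ((us @ [u]) @ vs))"
    using Suc.prems by (intro bex_cong refl Suc.IH) simp
  also have "\<dots> \<longleftrightarrow> (\<exists>vs \<in> tuples M (Suc k). sat_tup M \<phi> (us @ vs))"
  proof
    assume "\<exists>u \<in> univ M. \<exists>vs \<in> tuples M k. sat_tup M \<phi> ((us @ [u]) @ vs)"
    then obtain u vs where "u \<in> univ M" "vs \<in> tuples M k" "sat_tup M \<phi> (us @ u # vs)" by auto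
    then show "\<exists>vs \<in> tuples M (Suc k). sat_tup M \<phi> (us @ vs)"
      by (intro bexI[of _ "u # vs"]) (auto simp: tuples_def)
  next
    assume "\<exists>vs \<in> tuples M (Suc k). sat_tup M \<phi> (us @ vs)"
    then obtain u vs where "u \<in> univ M" "vs \<in> tuples M k" "sat_tup M \<phi> (us @ u # vs)"
      by (auto simp: tuples_def length_Suc_conv)
    then show "\<exists>u \<in> univ M. \<exists>vs \<in> tuples M k. sat_tup M \<phi> ((us @ [u]) @ vs)" by auto
  qed
  finally show ?case .
qed

section \<open>Ultrapowers\<close>

text \<open>Finer filters are smaller in the order on filters, so an ultrafilter is a minimal proper
  filter, and Zorn's lemma is applied to the reversed order. Lying below \<open>sequentially\<close>
  makes it nonprincipal.\<close>

lemma nonprincipal_ultrafilter_ex: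
  "\<exists>U :: nat filter. U \<noteq> bot \<and> U \<le> sequentially \<and>
     (\<forall>P. eventually P U \<or> eventually (\<lambda>n. \<not> P n) U)"
proof -
  define S where "S = {F :: nat filter. F \<noteq> bot \<and> F \<le> sequentially}"
  have "\<exists>u\<in>S. \<forall>a\<in>S. a \<le> u \<longrightarrow> a = u"
  proof (rule predicate_Zorn[of S "\<lambda>x y. y \<le> x"])
    show "partial_order_on S (relation_of (\<lambda>x y. y \<le> x) S)"
      by (auto simp: partial_order_on_def preorder_on_def refl_on_def trans_on_def trans_def antisym_def
          relation_of_def)
  next
    fix C assume C: "C \<in> Chains (relation_of (\<lambda>x y :: nat filter. y \<le> x) S)"
    then have CS: "C \<subseteq> S" and chain: "\<And>a b. a \<in> C \<Longrightarrow> b \<in> C \<Longrightarrow> a \<le> b \<or> b \<le> a"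
      by (auto simp: Chains_def relation_of_def)
    show "\<exists>u\<in>S. \<forall>a\<in>C. u \<le> a"
    proof (cases "C = {}")
      case True
      have "sequentially \<in> S" by (simp add: S_def)
      with True show ?thesis by auto
    next
      case False
      \<comment> \<open>In a chain, finitely many members have a least one, so whatever holds
        eventually in the infimum already holds eventually in one member. Hence the infimum stays
        proper.\<close>
      have "eventually P (Inf C) \<longleftrightarrow> (\<exists>F\<in>C. eventually P F)" for P
        using False chain by (intro eventually_Inf_base) (metis inf.idem inf.commute le_iff_inf order_refl)+
      then have "Inf C \<noteq> bot"
        using CS by (auto simp: trivial_limit_def S_def)
      moreover have "Inf C \<le> sequentially"
        using False CS by (auto simp: S_def intro: Inf_lower2)
      ultimately show ?thesis
        by (intro bexI[of _ "Inf C"]) (auto simp: S_def intro: Inf_lower)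
    qed
  qed
  then obtain U where U: "U \<in> S" "\<And>F. F \<in> S \<Longrightarrow> F \<le> U \<Longrightarrow> F = U" by blast
  have "eventually P U \<or> eventually (\<lambda>n. \<not> P n) U" for P
  proof (rule disjCI)
    assume nev: "\<not> eventually (\<lambda>n. \<not> P n) U"
    \<comment> \<open>Restricting \<open>U\<close> to the set where \<open>P\<close> holds keeps it
      proper, and minimality forces the restriction to be \<open>U\<close> itself.\<close>
    define F where "F = inf U (principal {n. P n})"
    have "F \<noteq> bot" using nev by (simp add: F_def trivial_limit_def eventually_inf_principal)
    moreover have "F \<le> U" by (simp add: F_def)
    ultimately have "F = U" using U by (auto simp: S_def intro: order_trans)
    moreover have "eventually P F" by (simp add: F_def eventually_inf_principal)
    ultimately show "eventually P U" by simp
  qed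
  with U show ?thesis by (auto simp: S_def)
qed

locale ultrafilter =
  fixes U :: "nat filter"
  assumes proper: "U \<noteq> bot"
    and ultra: "eventually P U \<or> eventually (\<lambda>n. \<not> P n) U"
begin

lemma eventually_not_iff: "eventually (\<lambda>n. \<not> P n) U \<longleftrightarrow> \<not> eventually P U"
  using ultra[of P] proper eventually_conj[of P U "\<lambda>n. \<not> P n"] by (auto simp: trivial_limit_def)

text \<open>The choice depends only on the class of \<open>g\<close> modulo \<open>U\<close>, so it
  selects a canonical representative. Elements of the ultrapower are thus functions that can be
  evaluated at an index, instead of equivalence classes.\<close>

definition rep :: "(nat \<Rightarrow> 'u) \<Rightarrow> nat \<Rightarrow> 'u" where
  "rep g = (SOME h. eventually (\<lambda>n. h n = g n) U)"

lemma rep: "eventually (\<lambda>n. rep g n = g n) U"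
  unfolding rep_def by (rule someI[of _ g]) simp

lemma rep_eq_iff: "rep g = rep h \<longleftrightarrow> eventually (\<lambda>n. g n = h n) U"
proof
  assume "rep g = rep h"
  then show "eventually (\<lambda>n. g n = h n) U"
    using rep[of g] rep[of h] by (auto elim: eventually_elim2)
next
  assume *: "eventually (\<lambda>n. g n = h n) U"
  have "eventually (\<lambda>n. k n = g n) U = eventually (\<lambda>n. k n = h n) U" for k
    using * by (auto elim: eventually_elim2)
  then show "rep g = rep h" by (simp add: rep_def)
qed

lemma rep_rep: "rep (rep g) = rep g"
  using rep[of g] by (simp add: rep_eq_iff)

definition ultrapower :: "('f, 'r, 'u) struct \<Rightarrow> ('f, 'r, nat \<Rightarrow> 'u) struct" where
  "ultrapower M = \<lparr>univ = rep ` {g. range g \<subseteq> univ M},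
     fint = (\<lambda>f us. rep (\<lambda>n. fint M f (map (\<lambda>g. g n) us))),
     rint = (\<lambda>r us. eventually (\<lambda>n. rint M r (map (\<lambda>g. g n) us)) U)\<rparr>"

lemma fint_ultrapower: "fint (ultrapower M) f us = rep (\<lambda>n. fint M f (map (\<lambda>g. g n) us))"
  by (simp add: ultrapower_def)

lemma rep_in_ultrapower: "range g \<subseteq> univ M \<Longrightarrow> rep g \<in> univ (ultrapower M)"
  by (simp add: ultrapower_def)

text \<open>The chosen representative of a class may leave \<open>univ M\<close> on a set of indices
  that \<open>U\<close> ignores.\<close>

lemma in_ultrapower_eventually:
  assumes "g \<in> univ (ultrapower M)" shows "eventually (\<lambda>n. g n \<in> univ M) U"
proof -
  obtain h where h: "g = rep h" "range h \<subseteq> univ M" using assms by (auto simp: ultrapower_def)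
  have "eventually (\<lambda>n. rep h n = h n) U" by (rule rep)
  then show ?thesis by eventually_elim (use h in auto)
qed

lemma in_ultrapower_rep: "g \<in> univ (ultrapower M) \<Longrightarrow> rep g = g"
  by (auto simp: ultrapower_def rep_rep)

lemma in_ultrapower_iff:
  assumes "univ M \<noteq> {}"
  shows "rep g \<in> univ (ultrapower M) \<longleftrightarrow> eventually (\<lambda>n. g n \<in> univ M) U"
proof
  assume "rep g \<in> univ (ultrapower M)"
  then have "eventually (\<lambda>n. rep g n \<in> univ M) U" by (rule in_ultrapower_eventually)
  with rep[of g] show "eventually (\<lambda>n. g n \<in> univ M) U" by eventually_elim simp
next
  assume *: "eventually (\<lambda>n. g n \<in> univ M) U"
  obtain u where u: "u \<in> univ M" using assms by blast
  define h where "h n = (if g n \<in> univ M then g n else u)" for n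
  have "rep g = rep h"
    unfolding rep_eq_iff using * by eventually_elim (simp add: h_def)
  then show "rep g \<in> univ (ultrapower M)"
    using u by (auto simp: h_def intro!: rep_in_ultrapower)
qed

lemma is_struct_ultrapower:
  assumes "is_struct L M" shows "is_struct L (ultrapower M)"
proof -
  have ne: "univ M \<noteq> {}" using assms by (simp add: is_struct_def)
  then obtain u where "u \<in> univ M" by blast
  then have "rep (\<lambda>_. u) \<in> univ (ultrapower M)" by (intro rep_in_ultrapower) auto
  moreover have "fint (ultrapower M) f us \<in> univ (ultrapower M)"
    if f: "(f, length us) \<in> funs L" and us: "set us \<subseteq> univ (ultrapower M)" for f us
  proof -
    have "eventually (\<lambda>n. \<forall>g\<in>set us. g n \<in> univ M) U"
      using us by (intro eventually_ball_finite) (auto intro: in_ultrapower_eventually)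
    then have "eventually (\<lambda>n. fint M f (map (\<lambda>g. g n) us) \<in> univ M) U"
    proof eventually_elim
      case (elim n)
      then have "set (map (\<lambda>g. g n) us) \<subseteq> univ M" by auto
      with assms f show ?case unfolding is_struct_def by (metis (mono_tags, lifting) case_prodD length_map)
    qed
    then have "rep (\<lambda>n. fint M f (map (\<lambda>g. g n) us)) \<in> univ (ultrapower M)"
      using in_ultrapower_iff[OF ne] by blast
    then show ?thesis by (simp only: fint_ultrapower)
  qed
  ultimately show ?thesis unfolding is_struct_def by blast
qed

lemma tval_ultrapower:
  "eventually (\<lambda>n. tval (ultrapower M) s t n = tval M (\<lambda>i. s i n) t) U"
proof (induction t)
  case (Fn f ts)
  have "eventually (\<lambda>n. \<forall>t\<in>set ts. tval (ultrapower M) s t n = tval M (\<lambda>i. s i n) t) U"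
    by (intro eventually_ball_finite) (auto intro: Fn.IH)
  moreover have "eventually (\<lambda>n. tval (ultrapower M) s (Fn f ts) n =
      fint M f (map (\<lambda>t. tval (ultrapower M) s t n) ts)) U"
    using rep[of "\<lambda>n. fint M f (map (\<lambda>t. tval (ultrapower M) s t n) ts)"]
    by (simp add: ultrapower_def comp_def)
  ultimately show ?case
    by eventually_elim (auto intro!: arg_cong[where f = "fint M f"])
qed simp

lemma rep_tval_ultrapower:
  assumes "\<And>i. i \<in> fv_trm t \<Longrightarrow> s i \<in> univ (ultrapower M)"
  shows "rep (tval (ultrapower M) s t) = tval (ultrapower M) s t"
proof (cases t)
  case (Fn f ts)
  then show ?thesis by (simp add: ultrapower_def rep_rep)
qed (use assms in \<open>auto intro: in_ultrapower_rep\<close>)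

text \<open>Negation is the case that rests on the maximality of \<open>U\<close>; the existential
  case assembles coordinatewise witnesses into one element.\<close>

lemma Los:
  assumes "\<And>i. i \<in> fv \<phi> \<Longrightarrow> s i \<in> univ (ultrapower M)"
  shows "sat (ultrapower M) s \<phi> \<longleftrightarrow> eventually (\<lambda>n. sat M (\<lambda>i. s i n) \<phi>) U"
  using assms
proof (induction \<phi> arbitrary: s)
  case (Equal t u)
  have "sat (ultrapower M) s (Equal t u)
      \<longleftrightarrow> rep (tval (ultrapower M) s t) = rep (tval (ultrapower M) s u)"
    using Equal by (simp add: rep_tval_ultrapower)
  also have "\<dots> \<longleftrightarrow> eventually (\<lambda>n. tval (ultrapower M) s t n = tval (ultrapower M) s u n) U"
    by (rule rep_eq_iff)
  also have "\<dots> \<longleftrightarrow> eventually (\<lambda>n. tval M (\<lambda>i. s i n) t = tval M (\<lambda>i. s i n) u) U"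
    by (rule eventually_cong, rule eventually_conj[OF tval_ultrapower[of M s t] tval_ultrapower[of M s u]])
      auto
  finally show ?case by simp
next
  case (Rel r ts)
  have "eventually (\<lambda>n. \<forall>t\<in>set ts. tval (ultrapower M) s t n = tval M (\<lambda>i. s i n) t) U"
    by (intro eventually_ball_finite) (auto intro: tval_ultrapower)
  then have "eventually (\<lambda>n. rint M r (map (\<lambda>t. tval (ultrapower M) s t n) ts)) U
      \<longleftrightarrow> eventually (\<lambda>n. rint M r (map (tval M (\<lambda>i. s i n)) ts)) U"
    by (rule eventually_cong) (auto cong: map_cong)
  then show ?case by (simp add: ultrapower_def comp_def)
next
  case (Neg \<phi>)
  then show ?case by (simp add: eventually_not_iff)
next
  case (Conj \<phi> \<psi>)
  then show ?case by (simp add: eventually_conj_iff)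
next
  case (Exi i \<phi>)
  have IH: "sat (ultrapower M) (s(i := g)) \<phi> \<longleftrightarrow> eventually (\<lambda>n. sat M ((\<lambda>i. s i n)(i := g n)) \<phi>) U"
    if "g \<in> univ (ultrapower M)" for g
  proof -
    have "(\<lambda>j. (s(i := g)) j n) = (\<lambda>i. s i n)(i := g n)" for n by auto
    then show ?thesis using Exi.IH[of "s(i := g)"] Exi.prems that by (simp del: fun_upd_apply) (simp add: fun_upd_def)
  qed
  show ?case
  proof
    assume "sat (ultrapower M) s (Exi i \<phi>)"
    then obtain g where g: "g \<in> univ (ultrapower M)"
        "eventually (\<lambda>n. sat M ((\<lambda>i. s i n)(i := g n)) \<phi>) U"
      using IH by auto
    from g(2) in_ultrapower_eventually[OF g(1)]
    show "eventually (\<lambda>n. sat M (\<lambda>i. s i n) (Exi i \<phi>)) U"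
      by eventually_elim auto
  next
    assume ev: "eventually (\<lambda>n. sat M (\<lambda>i. s i n) (Exi i \<phi>)) U"
    \<comment> \<open>At indices without a witness the choice is arbitrary; these are negligible for
      \<open>U\<close>.\<close>
    define g where "g n = (SOME u. u \<in> univ M \<and> sat M ((\<lambda>i. s i n)(i := u)) \<phi>)" for n
    have "g n \<in> univ M \<and> sat M ((\<lambda>i. s i n)(i := g n)) \<phi>" if "sat M (\<lambda>i. s i n) (Exi i \<phi>)" for n
      using that someI_ex[of "\<lambda>u. u \<in> univ M \<and> sat M ((\<lambda>i. s i n)(i := u)) \<phi>"]
      by (auto simp: g_def)
    then have g: "eventually (\<lambda>n. g n \<in> univ M \<and> sat M ((\<lambda>i. s i n)(i := g n)) \<phi>) U"
      using ev by (rule eventually_mono[rotated])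
    then have "univ M \<noteq> {}"
      using proper by (auto simp: eventually_False[symmetric] elim: eventually_mono)
    then have "rep g \<in> univ (ultrapower M)"
      using g by (simp add: in_ultrapower_iff eventually_conj_iff)
    moreover have "eventually (\<lambda>n. sat M ((\<lambda>i. s i n)(i := rep g n)) \<phi>) U"
      using g rep[of g] by eventually_elim simp
    ultimately show "sat (ultrapower M) s (Exi i \<phi>)"
      using IH[of "rep g"] by auto
  qed
qed

end

section \<open>Downward Loewenheim--Skolem\<close>

text \<open>The fallback \<open>u0\<close> gives a Skolem function that is total and stays in the
  universe.\<close>

definition witness :: "('f, 'r, 'u) struct \<Rightarrow> nat \<Rightarrow> ('f, 'r) fm \<Rightarrow> 'u list \<Rightarrow> 'u \<Rightarrow> 'u" where
  "witness A i \<phi> us u0 =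
     (if \<exists>u \<in> univ A. sat A (((!) us)(i := u)) \<phi>
      then SOME u. u \<in> univ A \<and> sat A (((!) us)(i := u)) \<phi> else u0)"

text \<open>
  Formulas serve as codes for Skolem terms: \<open>Neg c\<close> is the generator \<open>x c\<close>, and \<open>Conj (Exi i \<phi>) c\<close> is
  a Skolem function for \<open>Exi i \<phi>\<close> applied to the list of terms coded by \<open>c\<close>.
\<close>

fun decode :: "('f, 'r, 'u) struct \<Rightarrow> (('f, 'r) fm \<Rightarrow> 'u) \<Rightarrow> ('f, 'r) fm \<Rightarrow> 'u"
  and decodes :: "('f, 'r, 'u) struct \<Rightarrow> (('f, 'r) fm \<Rightarrow> 'u) \<Rightarrow> ('f, 'r) fm \<Rightarrow> 'u list" where
  "decode A x (Neg c) = x c"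
| "decode A x (Conj (Exi i \<phi>) c) = witness A i \<phi> (decodes A x c) (x c)"
| "decode A x c = x c"
| "decodes A x (Conj c cs) = decode A x c # decodes A x cs"
| "decodes A x c = []"

lemma decode_in_univ:
  assumes "range x \<subseteq> univ A" shows "decode A x c \<in> univ A"
proof -
  have x: "x c \<in> univ A" for c using assms by auto
  have w: "witness A i \<phi> us (x c) \<in> univ A" for i \<phi> us c
    using x[of c] someI_ex[of "\<lambda>u. u \<in> univ A \<and> sat A (((!) us)(i := u)) \<phi>"]
    unfolding witness_def by (auto simp del: fun_upd_apply)
  show ?thesis by (cases "(A, x, c)" rule: decode.cases) (simp_all add: x w)
qed

lemma decodes_surj: "set us \<subseteq> range (decode A x) \<Longrightarrow> \<exists>c. decodes A x c = us"
proof (induction us)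
  case Nil
  have "decodes A x (Neg c) = []" for c by simp
  then show ?case by blast
next
  case (Cons u us)
  then obtain c cs where "u = decode A x c" "decodes A x cs = us" by auto
  then have "decodes A x (Conj c cs) = u # us" by simp
  then show ?case by blast
qed

text \<open>This is the Tarski-Vaught condition for the set of values of Skolem terms: a parameter
  list of such values has a code, and prefixing it with the formula codes a witness.\<close>

lemma decode_witness:
  assumes "set us \<subseteq> range (decode A x)" "\<exists>u \<in> univ A. sat A (((!) us)(i := u)) \<phi>"
  shows "\<exists>u \<in> range (decode A x). sat A (((!) us)(i := u)) \<phi>"
proof -
  obtain c where c: "decodes A x c = us" using decodes_surj[OF assms(1)] by blast
  have "sat A (((!) us)(i := decode A x (Conj (Exi i \<phi>) c))) \<phi>"
    using assms(2) someI_ex[of "\<lambda>u. u \<in> univ A \<and> sat A (((!) us)(i := u)) \<phi>"]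
    by (simp add: c witness_def Bex_def del: fun_upd_apply)
  then show ?thesis by blast
qed

text \<open>A function value is the only witness of an equation with a fresh left-hand variable, so
  closure under functions is an instance of the Tarski-Vaught condition.\<close>

lemma decode_closed_fint:
  fixes A :: "('f, 'r, 'u) struct"
  assumes A: "is_struct L A" and f: "(f, length us) \<in> funs L"
    and x: "range x \<subseteq> univ A" and us: "set us \<subseteq> range (decode A x)"
  shows "fint A f us \<in> range (decode A x)"
proof -
  define n where "n = length us"
  define \<phi> where "\<phi> = (Equal (Var n) (Fn f (map Var [0..<n])) :: ('f, 'r) fm)"
  have "map (tval A (((!) us)(n := u)) \<circ> Var) [0..<n] = map ((!) us) [0..<n]" for u
    by (rule map_cong) auto
  also have "map ((!) us) [0..<n] = us" by (simp add: n_def map_nth)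
  finally have sat: "sat A (((!) us)(n := u)) \<phi> \<longleftrightarrow> u = fint A f us" for u
    by (simp add: \<phi>_def)
  have "set us \<subseteq> univ A" using us decode_in_univ[OF x] by auto
  then have "fint A f us \<in> univ A" using A f unfolding is_struct_def by blast
  then have "\<exists>u \<in> range (decode A x). sat A (((!) us)(n := u)) \<phi>"
    using us by (intro decode_witness) (auto simp only: sat)
  then show ?thesis by (auto simp only: sat)
qed

lemma Loewenheim_Skolem:
  fixes A :: "('f, 'r, 'u) struct" and x :: "('f, 'r) fm \<Rightarrow> 'u"
  assumes A: "is_struct L A" and x: "range x \<subseteq> univ A"
  shows "\<exists>(N :: ('f, 'r) small_struct) D.
     is_struct L N \<and> elementary_embedding L N A D \<and> range x \<subseteq> D ` univ N"
proof -
  define D where "D = decode A x"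
  \<comment> \<open>Many codes share a value. Keeping one code for each value makes \<open>D\<close>
    injective on the universe of \<open>N\<close>, so equality in \<open>N\<close> agrees with
    equality in \<open>A\<close>.\<close>
  define e where "e = inv_into UNIV D"
  have De: "D (e u) = u" if "u \<in> range D" for u using that by (simp add: e_def f_inv_into_f)
  have DA: "D c \<in> univ A" for c unfolding D_def by (rule decode_in_univ[OF x])
  define N :: "('f, 'r) small_struct" where
    "N = \<lparr>univ = e ` range D, fint = (\<lambda>f us. e (fint A f (map D us))),
          rint = (\<lambda>r us. rint A r (map D us))\<rparr>"
  have univN: "univ N = e ` range D" and fintN: "fint N f us = e (fint A f (map D us))"
    and rintN: "rint N r us = rint A r (map D us)" for f r us
    by (simp_all add: N_def)
  have fclosed: "fint A f us \<in> range D" if "(f, length us) \<in> funs L" "set us \<subseteq> range D" for f us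
    using that A x unfolding D_def by (intro decode_closed_fint)
  have "is_struct L N"
    unfolding is_struct_def
  proof (intro conjI ballI, safe)
    fix f us assume "(f, length us) \<in> funs L" "set us \<subseteq> univ N"
    then show "fint N f us \<in> univ N"
      using fclosed[of f "map D us"] by (simp add: univN fintN image_subset_iff)
  qed (simp add: univN)
  moreover have tv: "tval N s t \<in> univ N \<and> D (tval N s t) = tval A (D \<circ> s) t"
    if "wf_trm L t" "\<And>i. i \<in> fv_trm t \<Longrightarrow> s i \<in> univ N" for s t
    using that
  proof (induction t)
    case (Fn f ts)
    have IH: "D (tval N s t) = tval A (D \<circ> s) t" if "t \<in> set ts" for t
      using Fn.IH[OF that] Fn.prems that by (auto simp: comp_def)
    then have eq: "map (D \<circ> tval N s) ts = map (tval A (D \<circ> s)) ts" by simp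
    have "fint A f (map (D \<circ> tval N s) ts) \<in> range D"
      using Fn.prems by (intro fclosed) auto
    with eq show ?case by (simp add: fintN univN De comp_def cong: map_cong)
  qed simp
  have sat_iff: "sat N s \<phi> \<longleftrightarrow> sat A (D \<circ> s) \<phi>"
    if "wf_fm L \<phi>" "\<And>i. i \<in> fv \<phi> \<Longrightarrow> s i \<in> univ N" for s \<phi>
    using that
  proof (induction \<phi> arbitrary: s)
    case (Equal t u)
    have "inj_on D (univ N)" by (auto simp: inj_on_def univN De)
    moreover have "tval N s v \<in> univ N" "D (tval N s v) = tval A (D \<circ> s) v" if "v = t \<or> v = u" for v
      using tv[of v s] Equal that by auto
    ultimately show ?case by (metis inj_on_eq_iff sat.simps(1))
  next
    case (Rel r ts)
    have "D (tval N s t) = tval A (D \<circ> s) t" if "t \<in> set ts" for t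
      using Rel that by (intro conjunct2[OF tv]) auto
    then have "map (D \<circ> tval N s) ts = map (tval A (D \<circ> s)) ts" by simp
    then show ?case by (simp add: rintN comp_def cong: map_cong)
  next
    case (Exi i \<phi>)
    have IH: "sat N (s(i := c)) \<phi> \<longleftrightarrow> sat A ((D \<circ> s)(i := D c)) \<phi>" if "c \<in> univ N" for c
    proof -
      have "D \<circ> s(i := c) = (D \<circ> s)(i := D c)" by auto
      then show ?thesis using Exi.IH[of "s(i := c)"] Exi.prems that
        by (simp del: fun_upd_apply) (simp add: fun_upd_def)
    qed
    show ?case
    proof
      assume "sat N s (Exi i \<phi>)"
      then obtain c where "c \<in> univ N" "sat N (s(i := c)) \<phi>" by auto
      then show "sat A (D \<circ> s) (Exi i \<phi>)" using IH[of c] DA[of c] by auto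
    next
      assume "sat A (D \<circ> s) (Exi i \<phi>)"
      then obtain u where u: "u \<in> univ A" "sat A ((D \<circ> s)(i := u)) \<phi>" by auto
      \<comment> \<open>\<open>m\<close> exceeds every free variable, so the part of the assignment
        that matters fits into a finite list, as the coding of parameters requires.\<close>
      define m where "m = Suc (Max (insert 0 (fv \<phi>)))"
      define us where "us = map (D \<circ> s) [0..<m]"
      have m: "j < m" if "j \<in> fv \<phi>" for j
        using that finite_fv[of \<phi>] Max_ge[of "insert 0 (fv \<phi>)" j] by (simp add: m_def less_Suc_eq_le)
      have eq: "sat A (((!) us)(i := u)) \<phi> \<longleftrightarrow> sat A ((D \<circ> s)(i := u)) \<phi>" for u
        by (rule sat_cong) (auto simp: us_def m)
      have "\<exists>u \<in> range D. sat A (((!) us)(i := u)) \<phi>"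
        unfolding D_def by (rule decode_witness)
          (use u eq in \<open>auto simp: us_def D_def[symmetric] simp del: fun_upd_apply\<close>)
      then obtain c where "sat A ((D \<circ> s)(i := D c)) \<phi>"
        unfolding eq by blast
      then have "sat A ((D \<circ> s)(i := D (e (D c)))) \<phi>" "e (D c) \<in> univ N"
        by (simp_all add: De univN)
      then show "sat N s (Exi i \<phi>)" using IH by auto
    qed
  qed auto
  have "sat_tup N \<phi> us \<longleftrightarrow> sat_tup A \<phi> (map D us)"
    if "wf_fm L \<phi>" "set us \<subseteq> univ N" "fv \<phi> \<subseteq> {..<length us}" for \<phi> us
  proof -
    have "sat_tup N \<phi> us \<longleftrightarrow> sat A (D \<circ> (!) us) \<phi>"
      unfolding sat_tup_def using that by (intro sat_iff) (auto simp: subset_iff)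
    also have "\<dots> \<longleftrightarrow> sat_tup A \<phi> (map D us)"
      unfolding sat_tup_def using that by (intro sat_cong) (auto simp: subset_iff)
    finally show ?thesis .
  qed
  then have "elementary_embedding L N A D"
    using DA by (auto simp: elementary_embedding_def)
  moreover have "range x \<subseteq> D ` univ N"
  proof
    fix u assume "u \<in> range x"
    then obtain c where "u = x c" by blast
    then have "u = D (Neg c)" by (simp add: D_def)
    then have "u \<in> range D" by blast
    then show "u \<in> D ` univ N" unfolding univN by (intro image_eqI[of u D "e u"]) (simp_all add: De)
  qed
  ultimately show ?thesis by blast
qed

section \<open>From finite patterns to TP2\<close>

context ultrafilter
begin

section \<open>Tuples of the ultrapower as sequences of tuples\<close>

definition lift :: "nat \<Rightarrow> (nat \<Rightarrow> 'u list) \<Rightarrow> (nat \<Rightarrow> 'u) list" where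
  "lift k g = map (\<lambda>j. rep (\<lambda>n. g n ! j)) [0..<k]"

lemma length_lift [simp]: "length (lift k g) = k"
  by (simp add: lift_def)

lemma lift_in_tuples:
  assumes "\<And>n. g n \<in> tuples M k" shows "lift k g \<in> tuples (ultrapower M) k"
proof -
  have "range (\<lambda>n. g n ! j) \<subseteq> univ M" if "j < k" for j
    using assms that nth_mem by (fastforce simp: tuples_def)
  then have "rep (\<lambda>n. g n ! j) \<in> univ (ultrapower M)" if "j < k" for j
    using that by (intro rep_in_ultrapower)
  then show ?thesis by (auto simp: lift_def tuples_def)
qed

lemma lift_append:
  assumes "\<And>n. length (g n) = k"
  shows "lift (k + l) (\<lambda>n. g n @ h n) = lift k g @ lift l h"
  using assms by (intro nth_equalityI) (auto simp: lift_def nth_append)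

lemma tuples_ultrapower_ex_lift:
  assumes "us \<in> tuples (ultrapower M) k"
  shows "\<exists>g. (\<forall>n. g n \<in> tuples M k) \<and> us = lift k g"
proof -
  have "\<forall>j<k. \<exists>h. us ! j = rep h \<and> range h \<subseteq> univ M"
    using assms by (auto simp: tuples_def ultrapower_def dest!: nth_mem)
  then obtain h where h: "\<And>j. j < k \<Longrightarrow> us ! j = rep (h j) \<and> range (h j) \<subseteq> univ M" by metis
  define g where "g n = map (\<lambda>j. h j n) [0..<k]" for n
  have "g n \<in> tuples M k" for n using h by (fastforce simp: g_def tuples_def)
  moreover have "us = lift k g"
    using assms h by (intro nth_equalityI) (auto simp: g_def tuples_def lift_def)
  ultimately show ?thesis by blast
qed

lemma Los_lift:
  assumes "\<And>n. g n \<in> tuples M k" "fv \<phi> \<subseteq> {..<k}"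
  shows "sat_tup (ultrapower M) \<phi> (lift k g) \<longleftrightarrow> eventually (\<lambda>n. sat_tup M \<phi> (g n)) U"
proof -
  have "sat_tup (ultrapower M) \<phi> (lift k g) \<longleftrightarrow> eventually (\<lambda>n. sat M (\<lambda>i. (lift k g ! i) n) \<phi>) U"
    unfolding sat_tup_def
  proof (intro Los)
    fix i assume "i \<in> fv \<phi>"
    then have "i < length (lift k g)" using assms(2) by auto
    then have "lift k g ! i \<in> set (lift k g)" by (rule nth_mem)
    then show "lift k g ! i \<in> univ (ultrapower M)"
      using lift_in_tuples[of g M k, OF assms(1)] by (auto simp: tuples_def)
  qed
  also have "eventually (\<lambda>n. \<forall>i\<in>{..<k}. (lift k g ! i) n = g n ! i) U"
    by (intro eventually_ball_finite) (auto simp: lift_def intro: rep)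
  then have "eventually (\<lambda>n. sat M (\<lambda>i. (lift k g ! i) n) \<phi>) U \<longleftrightarrow> eventually (\<lambda>n. sat_tup M \<phi> (g n)) U"
    by (rule eventually_cong) (use assms in \<open>auto simp: sat_tup_def intro!: sat_cong\<close>)
  finally show ?thesis .
qed

end

text \<open>The common solvability of two instances as a property of their parameters alone. The
  parameters take the first \<open>n + n\<close> variables and the solution the next
  \<open>m\<close>, where \<open>Exis\<close> can bind it.\<close>

definition joint :: "nat \<Rightarrow> nat \<Rightarrow> ('f, 'r) fm \<Rightarrow> ('f, 'r) fm" where
  "joint m n \<phi> = Exis (n + n) m
     (Conj (rename (\<lambda>v. if v < m then n + n + v else v - m) \<phi>)
           (rename (\<lambda>v. if v < m then n + n + v else n + (v - m)) \<phi>))"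

lemma joint:
  assumes fv: "fv \<phi> \<subseteq> {..<m + n}"
  shows "wf_fm L (joint m n \<phi>) = wf_fm L \<phi>" "fv (joint m n \<phi>) \<subseteq> {..<n + n}"
    "length a = n \<Longrightarrow> length a' = n \<Longrightarrow> sat_tup M (joint m n \<phi>) (a @ a') \<longleftrightarrow>
       (\<exists>b \<in> tuples M m. sat_tup M \<phi> (b @ a) \<and> sat_tup M \<phi> (b @ a'))"
proof -
  define \<rho> where "\<rho> = (\<lambda>v. if v < m then n + n + v else v - m)"
  define \<rho>' where "\<rho>' = (\<lambda>v. if v < m then n + n + v else n + (v - m))"
  define \<psi> where "\<psi> = Conj (rename \<rho> \<phi>) (rename \<rho>' \<phi>)"
  have j: "joint m n \<phi> = Exis (n + n) m \<psi>" by (simp add: joint_def \<psi>_def \<rho>_def \<rho>'_def)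
  have "\<rho> ` fv \<phi> \<subseteq> {..<n + n + m}" "\<rho>' ` fv \<phi> \<subseteq> {..<n + n + m}"
    using fv by (auto simp: \<rho>_def \<rho>'_def subset_iff less_diff_conv2)
  then have \<psi>: "fv \<psi> \<subseteq> {..<n + n + m}"
    unfolding \<psi>_def fv.simps by (intro Un_least order_trans[OF fv_rename])
  show "wf_fm L (joint m n \<phi>) = wf_fm L \<phi>" by (simp add: j \<psi>_def)
  show "fv (joint m n \<phi>) \<subseteq> {..<n + n}" using \<psi> by (auto simp: j fv_Exis subset_iff)
  assume a: "length a = n" "length a' = n"
  have "sat_tup M (joint m n \<phi>) (a @ a') \<longleftrightarrow> (\<exists>b \<in> tuples M m. sat_tup M \<psi> ((a @ a') @ b))"
    using sat_tup_Exis[of \<psi> "a @ a'" m M] \<psi> a by (simp add: j)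
  moreover have "sat_tup M \<psi> ((a @ a') @ b) \<longleftrightarrow> sat_tup M \<phi> (b @ a) \<and> sat_tup M \<phi> (b @ a')"
    if "b \<in> tuples M m" for b
  proof -
    have b: "length b = m" using that by (simp add: tuples_def)
    have "sat_tup M (rename \<rho> \<phi>) ((a @ a') @ b) = sat_tup M \<phi> (b @ a)"
      using fv a b by (intro sat_tup_rename) (auto simp: \<rho>_def nth_append subset_iff)
    moreover have "sat_tup M (rename \<rho>' \<phi>) ((a @ a') @ b) = sat_tup M \<phi> (b @ a')"
      using fv a b by (intro sat_tup_rename) (auto simp: \<rho>'_def nth_append subset_iff)
    ultimately show ?thesis by (simp add: \<psi>_def sat_tup_def)
  qed
  ultimately show "sat_tup M (joint m n \<phi>) (a @ a') \<longleftrightarrow>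
       (\<exists>b \<in> tuples M m. sat_tup M \<phi> (b @ a) \<and> sat_tup M \<phi> (b @ a'))" by simp
qed

lemma elementary_embedding_tup:
  assumes "elementary_embedding L M N e" "wf_fm L \<phi>" "us \<in> tuples M k" "fv \<phi> \<subseteq> {..<k}"
  shows "sat_tup M \<phi> us \<longleftrightarrow> sat_tup N \<phi> (map e us)"
  using assms by (auto simp: elementary_embedding_def tuples_def)

text \<open>A pattern with \<open>N\<close> rows is placed at coordinate \<open>N\<close> of an
  ultrapower, so each fixed row is correct at almost all coordinates. Loewenheim-Skolem then moves
  the array, and later each realisation of a path, to structures on the type of formulas.\<close>

lemma has_TP2_if_finite_patterns:
  fixes M :: "('f, 'r, 'm) struct"
  assumes M: "is_struct L M" and wf: "wf_fm L \<phi>" and fv: "fv \<phi> \<subseteq> {..<m + n}"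
    and pat: "\<And>N. \<exists>a :: nat \<Rightarrow> nat \<Rightarrow> 'm list. (\<forall>i j. a i j \<in> tuples M n) \<and>
      (\<forall>i<N. \<forall>j j'. j \<noteq> j' \<longrightarrow>
         \<not> (\<exists>b \<in> tuples M m. sat_tup M \<phi> (b @ a i j) \<and> sat_tup M \<phi> (b @ a i j'))) \<and>
      (\<forall>f. \<exists>b \<in> tuples M m. \<forall>i<N. sat_tup M \<phi> (b @ a i (f i)))" (is "\<And>N. \<exists>a. ?Q N a")
  shows "has_TP2 L (complete_theory L M) \<phi> m n"
proof -
  obtain U :: "nat filter" where U: "U \<noteq> bot" "U \<le> sequentially"
      "\<And>P. eventually P U \<or> eventually (\<lambda>n. \<not> P n) U"
    using nonprincipal_ultrafilter_ex by blast
  interpret ultrafilter U using U by unfold_locales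
  define P where "P = ultrapower M"
  have P: "is_struct L P" unfolding P_def by (rule is_struct_ultrapower[OF M])
  have "\<exists>a. \<forall>N. ?Q N (a N)" by (rule choice) (rule allI, rule pat)
  then obtain a where "\<forall>N. ?Q N (a N)" ..
  then have a: "\<And>N i j. a N i j \<in> tuples M n"
      "\<And>N i j j'. i < N \<Longrightarrow> j \<noteq> j' \<Longrightarrow>
         \<not> (\<exists>b \<in> tuples M m. sat_tup M \<phi> (b @ a N i j) \<and> sat_tup M \<phi> (b @ a N i j'))"
      "\<And>N f. \<exists>b \<in> tuples M m. \<forall>i<N. sat_tup M \<phi> (b @ a N i (f i))"
    by simp_all
  define A where "A i j = lift n (\<lambda>N. a N i j)" for i j
  have A: "A i j \<in> tuples P n" for i j
    unfolding A_def P_def by (intro lift_in_tuples a)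
  have lift_sat: "sat_tup P \<phi> (lift m g @ A i j) \<longleftrightarrow> eventually (\<lambda>N. sat_tup M \<phi> (g N @ a N i j)) U"
    if "\<And>N. g N \<in> tuples M m" for g i j
  proof -
    have eq: "lift m g @ A i j = lift (m + n) (\<lambda>N. g N @ a N i j)"
      unfolding A_def using that by (intro lift_append[symmetric]) (auto simp: tuples_def)
    have "g N @ a N i j \<in> tuples M (m + n)" for N
      using that[of N] a(1)[of N i j] by (auto simp: tuples_def)
    then show ?thesis unfolding P_def eq by (rule Los_lift) (rule fv)
  qed
  have row: "\<not> (\<exists>b \<in> tuples P m. sat_tup P \<phi> (b @ A i j) \<and> sat_tup P \<phi> (b @ A i j'))"
    if "j \<noteq> j'" for i j j'
  proof
    assume "\<exists>b \<in> tuples P m. sat_tup P \<phi> (b @ A i j) \<and> sat_tup P \<phi> (b @ A i j')"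
    then obtain b where b: "b \<in> tuples P m" "sat_tup P \<phi> (b @ A i j)" "sat_tup P \<phi> (b @ A i j')"
      by blast
    from tuples_ultrapower_ex_lift[OF b(1)[unfolded P_def]]
    obtain g where g1: "\<forall>N. g N \<in> tuples M m" and b': "b = lift m g" by blast
    note g = g1[rule_format] b(2,3)[unfolded b']
    \<comment> \<open>Row \<open>i\<close> is guaranteed to be inconsistent only at coordinates
      beyond \<open>i\<close>, which are almost all of them as \<open>U\<close> is
      nonprincipal.\<close>
    have "eventually (\<lambda>N. i < N) U" using U(2) eventually_gt_at_top by (rule filter_leD)
    with g(2,3)[unfolded lift_sat[OF g(1)]] have "eventually (\<lambda>N. False) U"
      by eventually_elim (use a(2) g(1) that in blast)
    with U(1) show False by (simp add: trivial_limit_def)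
  qed
  have path: "\<exists>b \<in> tuples P m. \<forall>i. sat_tup P \<phi> (b @ A i (f i))" for f
  proof -
    \<comment> \<open>The point at coordinate \<open>N\<close> meets the first \<open>N\<close>
      conditions of the path, so each single condition fails at finitely many coordinates at
      most.\<close>
    obtain g where g: "\<And>N. g N \<in> tuples M m" "\<And>N i. i < N \<Longrightarrow> sat_tup M \<phi> (g N @ a N i (f i))"
      using a(3)[of _ f] by metis
    have "sat_tup P \<phi> (lift m g @ A i (f i))" for i
    proof -
      have "eventually (\<lambda>N. i < N) U" using U(2) eventually_gt_at_top by (rule filter_leD)
      then show ?thesis unfolding lift_sat[OF g(1)] by eventually_elim (rule g(2))
    qed
    moreover have "lift m g \<in> tuples P m" unfolding P_def by (intro lift_in_tuples g)
    ultimately show ?thesis by blast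
  qed
  obtain u0 where u0: "u0 \<in> univ P" using P by (auto simp: is_struct_def)
  \<comment> \<open>A triple of nested quantifiers encodes the indices of one entry of the array, so
    that every entry becomes a generator of the small structure.\<close>
  define x :: "('f, 'r) fm \<Rightarrow> nat \<Rightarrow> 'm" where
    "x q = (case q of Exi i (Exi j (Exi k _)) \<Rightarrow> if k < n then A i j ! k else u0 | _ \<Rightarrow> u0)" for q
  have "A i j ! k \<in> univ P" if "k < n" for i j k using A[of i j] that by (auto simp: tuples_def)
  then have "range x \<subseteq> univ P" using u0 by (auto simp: x_def split: fm.split)
  from Loewenheim_Skolem[OF P this] obtain N :: "('f, 'r) small_struct" and D where
    N: "is_struct L N" "elementary_embedding L N P D" "range x \<subseteq> D ` univ N" by blast
  have "\<exists>c \<in> tuples N n. map D c = A i j" for i j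
  proof -
    have "A i j ! k \<in> D ` univ N" if "k < n" for k
      using that by (intro subsetD[OF N(3)] range_eqI[of _ _ "Exi i (Exi j (Exi k undefined))"]) (simp add: x_def)
    then have "set (A i j) \<subseteq> D ` univ N" using A[of i j] by (auto simp: tuples_def in_set_conv_nth)
    then have "A i j \<in> map D ` lists (univ N)"
      by (metis in_lists_conv_set lists_image subset_iff)
    then show ?thesis using A[of i j] by (force simp: tuples_def)
  qed
  then obtain c where c: "\<And>i j. c i j \<in> tuples N n" "\<And>i j. map D (c i j) = A i j" by metis
  have mapD: "map D us \<in> tuples P k" if "us \<in> tuples N k" for us k
    using that N(2) by (auto simp: tuples_def elementary_embedding_def)
  have "is_model L (complete_theory L M) N"
    unfolding is_model_def
  proof (intro conjI ballI N)
    fix \<psi> assume "\<psi> \<in> complete_theory L M"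
    then have \<psi>: "wf_fm L \<psi>" "fv \<psi> = {}" "sat_tup M \<psi> []"
      by (auto simp: complete_theory_def sentences_def)
    have "sat_tup P \<psi> (lift 0 (\<lambda>_. []))"
      unfolding P_def using \<psi> by (subst Los_lift) (auto simp: tuples_def)
    then have "sat_tup P \<psi> (map D [])" by (simp add: lift_def)
    then show "sat_tup N \<psi> []"
      using \<psi> elementary_embedding_tup[OF N(2), of \<psi> "[]" 0] by (simp add: tuples_def)
  qed
  moreover have "\<not> consistent L N \<phi> m (c i ` J)" if J: "finite J" "card J = 2" for i J
  proof
    obtain j j' where j: "J = {j, j'}" "j \<noteq> j'" using J(2) by (auto simp: card_2_iff)
    assume "consistent L N \<phi> m (c i ` J)"
    then obtain N' :: "('f, 'r) small_struct" and e b where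
      N': "elementary_embedding L N N' e" "b \<in> tuples N' m"
        "sat_tup N' \<phi> (b @ map e (c i j))" "sat_tup N' \<phi> (b @ map e (c i j'))"
      by (auto simp: consistent_def j)
    have len: "length (c i k) = n" for k using c(1)[of i k] by (simp add: tuples_def)
    \<comment> \<open>The realisation \<open>b\<close> itself lives in the extension; what descends
      to \<open>N\<close> is the existence of one, which is why the formula \<open>joint\<close> is
      evaluated here.\<close>
    have "sat_tup N' (joint m n \<phi>) (map e (c i j @ c i j'))"
      using N' joint(3)[OF fv, of "map e (c i j)" "map e (c i j')" N'] len by auto
    then have "sat_tup N (joint m n \<phi>) (c i j @ c i j')"
      using elementary_embedding_tup[OF N'(1), of "joint m n \<phi>" "c i j @ c i j'" "n + n"]
        joint(1,2)[OF fv] wf c(1) by (auto simp: tuples_def)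
    then obtain b where b: "b \<in> tuples N m" "sat_tup N \<phi> (b @ c i j)" "sat_tup N \<phi> (b @ c i j')"
      using joint(3)[OF fv] len by blast
    have "sat_tup P \<phi> (map D b @ A i k)" if "sat_tup N \<phi> (b @ c i k)" for k
    proof -
      have "b @ c i k \<in> tuples N (m + n)" using b(1) c(1)[of i k] by (auto simp: tuples_def)
      from elementary_embedding_tup[OF N(2) wf this fv] that show ?thesis by (simp add: c(2))
    qed
    with b row[OF j(2), of i] mapD[OF b(1)] show False by blast
  qed
  moreover have "consistent L N \<phi> m (range (\<lambda>i. c i (f i)))" for f
  proof -
    obtain b where b: "b \<in> tuples P m" "\<And>i. sat_tup P \<phi> (b @ A i (f i))" using path by blast
    \<comment> \<open>The generators must include both the image of \<open>N\<close> and the entries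
      of the realisation \<open>b\<close>; two different constructors keep their codes
      apart.\<close>
    define y :: "('f, 'r) fm \<Rightarrow> nat \<Rightarrow> 'm" where
      "y q = (case q of Neg r \<Rightarrow> if r \<in> univ N then D r else u0
                | Exi k r \<Rightarrow> if k < m then b ! k else u0 | _ \<Rightarrow> u0)" for q
    have DP: "D ` univ N \<subseteq> univ P" using N(2) by (simp add: elementary_embedding_def)
    then have y: "range y \<subseteq> univ P"
      using b(1) u0 by (auto simp: y_def tuples_def image_subset_iff subset_iff split: fm.split)
    from Loewenheim_Skolem[OF P y] obtain N' :: "('f, 'r) small_struct" and D' where
      N': "is_struct L N'" "elementary_embedding L N' P D'" "range y \<subseteq> D' ` univ N'" by blast
    have "D r \<in> range y" if "r \<in> univ N" for r
      using that by (intro range_eqI[of _ _ "Neg r"]) (simp add: y_def)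
    then have "\<forall>r \<in> univ N. \<exists>r' \<in> univ N'. D' r' = D r" using N'(3) by (metis imageE subset_iff)
    then obtain e where e: "\<And>r. r \<in> univ N \<Longrightarrow> e r \<in> univ N' \<and> D' (e r) = D r" by metis
    have "b ! k \<in> D' ` univ N'" if "k < m" for k
      using that by (intro subsetD[OF N'(3)] range_eqI[of _ _ "Exi k undefined"]) (simp add: y_def)
    then have "set b \<subseteq> D' ` univ N'" using b(1) by (auto simp: tuples_def in_set_conv_nth)
    then have "b \<in> map D' ` lists (univ N')"
      by (metis in_lists_conv_set lists_image subset_iff)
    then obtain b' where b': "b' \<in> tuples N' m" "map D' b' = b" using b(1) by (force simp: tuples_def)
    \<comment> \<open>\<open>D'\<close> after \<open>e\<close> agrees with \<open>D\<close> on
      \<open>N\<close>, and both \<open>D\<close> and \<open>D'\<close> are elementary, so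
      \<open>e\<close> is elementary too.\<close>
    have "elementary_embedding L N N' e"
      unfolding elementary_embedding_def
    proof (intro conjI allI impI)
      show "e ` univ N \<subseteq> univ N'" using e by auto
      fix \<psi> us assume *: "wf_fm L \<psi> \<and> set us \<subseteq> univ N \<and> fv \<psi> \<subseteq> {..<length us}"
      then have "map e us \<in> tuples N' (length us)" using e by (auto simp: tuples_def)
      with * have "sat_tup N' \<psi> (map e us) \<longleftrightarrow> sat_tup P \<psi> (map D' (map e us))"
        by (intro elementary_embedding_tup[OF N'(2)]) auto
      also have "map D' (map e us) = map D us" using * e by auto
      also have "sat_tup P \<psi> (map D us) \<longleftrightarrow> sat_tup N \<psi> us"
        using * by (intro elementary_embedding_tup[OF N(2), symmetric]) (auto simp: tuples_def)
      finally show "sat_tup N \<psi> us \<longleftrightarrow> sat_tup N' \<psi> (map e us)" by simp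
    qed
    moreover have "sat_tup N' \<phi> (b' @ map e (c i (f i)))" for i
    proof -
      have t: "b' @ map e (c i (f i)) \<in> tuples N' (m + n)"
        using b'(1) c(1)[of i "f i"] e by (auto simp: tuples_def)
      have "map D' (map e (c i (f i))) = map D (c i (f i))"
        using c(1)[of i "f i"] e by (auto simp: tuples_def)
      then have "map D' (b' @ map e (c i (f i))) = b @ A i (f i)"
        by (simp only: map_append b'(2) c(2))
      with elementary_embedding_tup[OF N'(2) wf t fv] b(2)[of i] show ?thesis by simp
    qed
    ultimately show ?thesis
      using N'(1) b'(1) unfolding consistent_def by blast
  qed
  ultimately show ?thesis
    using c(1) unfolding has_TP2_def by blast
qed

section \<open>Definable relations between tuples\<close>

lemma length_concat_uniform:
  assumes "\<And>b. b \<in> set bs \<Longrightarrow> length b = d" shows "length (concat bs) = length bs * d"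
  using assms by (induction bs) auto

lemma concat_nth_uniform:
  assumes "\<And>b. b \<in> set bs \<Longrightarrow> length b = d" "i < length bs * d"
  shows "concat bs ! i = bs ! (i div d) ! (i mod d)"
  using assms
proof (induction bs arbitrary: i)
  case (Cons b bs)
  have d: "length b = d" "d > 0" using Cons.prems by (auto intro: Nat.gr0I)
  show ?case
  proof (cases "i < d")
    case False
    then obtain j where j: "i = d + j" using le_Suc_ex not_less by blast
    have "concat bs ! j = bs ! (j div d) ! (j mod d)"
      using Cons j by (intro Cons.IH) auto
    then show ?thesis using d by (simp add: j nth_append)
  qed (use d in \<open>simp add: nth_append\<close>)
qed simp

locale definability =
  fixes L :: "('f, 'r) lang" and M :: "('f, 'r, 'm) struct" and d :: nat
begin

text \<open>A \<open>k\<close>-ary relation between \<open>d\<close>-tuples is given as a predicate on lists, which is arbitrary on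
  lists that do not consist of \<open>k\<close> such tuples.\<close>

definition definable_rel :: "nat \<Rightarrow> ('m list list \<Rightarrow> bool) \<Rightarrow> bool" where
  "definable_rel k R \<longleftrightarrow>
     (\<exists>\<phi> cs. wf_fm L \<phi> \<and> set cs \<subseteq> univ M \<and> fv \<phi> \<subseteq> {..<k * d + length cs} \<and>
        (\<forall>bs. length bs = k \<and> set bs \<subseteq> tuples M d \<longrightarrow> (R bs \<longleftrightarrow> sat_tup M \<phi> (concat bs @ cs))))"

lemma definable_rel_cong:
  assumes "definable_rel k R"
    and "\<And>bs. length bs = k \<Longrightarrow> set bs \<subseteq> tuples M d \<Longrightarrow> R' bs \<longleftrightarrow> R bs"
  shows "definable_rel k R'"
  using assms unfolding definable_rel_def by auto

lemma length_concat_tuples: "set bs \<subseteq> tuples M d \<Longrightarrow> length (concat bs) = length bs * d"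
  by (rule length_concat_uniform) (auto simp: tuples_def)

lemma nth_concat_tuples:
  "set bs \<subseteq> tuples M d \<Longrightarrow> i < length bs * d \<Longrightarrow> concat bs ! i = bs ! (i div d) ! (i mod d)"
  by (rule concat_nth_uniform) (auto simp: tuples_def)

section \<open>Closure properties of definable relations\<close>

lemma definable_rel_of_set:
  assumes "definable_set L M (k * d) S" shows "definable_rel k (\<lambda>bs. concat bs \<in> S)"
proof -
  obtain \<phi> cs where \<phi>: "wf_fm L \<phi>" "set cs \<subseteq> univ M" "fv \<phi> \<subseteq> {..<k * d + length cs}"
      "S = {us \<in> tuples M (k * d). sat_tup M \<phi> (us @ cs)}"
    using assms by (auto simp: definable_set_def)
  have "concat bs \<in> tuples M (k * d)" if "length bs = k" "set bs \<subseteq> tuples M d" for bs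
    using length_concat_tuples[OF that(2)] that by (auto simp: tuples_def)
  with \<phi> show ?thesis unfolding definable_rel_def by blast
qed

lemma definable_rel_conj:
  assumes "definable_rel k R" "definable_rel k R'"
  shows "definable_rel k (\<lambda>bs. R bs \<and> R' bs)"
proof -
  obtain \<phi> cs where \<phi>: "wf_fm L \<phi>" "set cs \<subseteq> univ M" "fv \<phi> \<subseteq> {..<k * d + length cs}"
      "\<And>bs. length bs = k \<Longrightarrow> set bs \<subseteq> tuples M d \<Longrightarrow> R bs \<longleftrightarrow> sat_tup M \<phi> (concat bs @ cs)"
    using assms(1) by (auto simp: definable_rel_def)
  obtain \<phi>' cs' where \<phi>': "wf_fm L \<phi>'" "set cs' \<subseteq> univ M" "fv \<phi>' \<subseteq> {..<k * d + length cs'}"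
      "\<And>bs. length bs = k \<Longrightarrow> set bs \<subseteq> tuples M d \<Longrightarrow> R' bs \<longleftrightarrow> sat_tup M \<phi>' (concat bs @ cs')"
    using assms(2) by (auto simp: definable_rel_def)
  \<comment> \<open>The parameter variables of the second formula move past those of the
    first.\<close>
  define \<rho> where "\<rho> v = (if v < k * d then v else v + length cs)" for v
  define \<psi> where "\<psi> = Conj \<phi> (rename \<rho> \<phi>')"
  have "\<rho> ` fv \<phi>' \<subseteq> {..<k * d + length (cs @ cs')}"
    using \<phi>'(3) by (auto simp: \<rho>_def)
  then have "fv \<psi> \<subseteq> {..<k * d + length (cs @ cs')}"
    using \<phi>(3) unfolding \<psi>_def fv.simps by (intro Un_least order_trans[OF fv_rename]) auto
  moreover have "R bs \<and> R' bs \<longleftrightarrow> sat_tup M \<psi> (concat bs @ cs @ cs')"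
    if bs: "length bs = k" "set bs \<subseteq> tuples M d" for bs
  proof -
    have len: "length (concat bs) = k * d" using length_concat_tuples bs by simp
    have "sat_tup M \<phi> ((concat bs @ cs) @ cs') = sat_tup M \<phi> (concat bs @ cs)"
      using \<phi>(3) len by (intro sat_tup_append_ignore) simp
    moreover have "sat_tup M (rename \<rho> \<phi>') (concat bs @ cs @ cs') = sat_tup M \<phi>' (concat bs @ cs')"
      using \<phi>'(3) len by (intro sat_tup_rename) (auto simp: \<rho>_def nth_append subset_iff)
    ultimately show ?thesis
      using \<phi>(4)[OF bs] \<phi>'(4)[OF bs] by (simp add: \<psi>_def sat_tup_def)
  qed
  ultimately show ?thesis
    unfolding definable_rel_def using \<phi>(1,2) \<phi>'(1,2)
    by (intro exI[of _ \<psi>] exI[of _ "cs @ cs'"]) (auto simp: \<psi>_def)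
qed

text \<open>The index list permutes, repeats or omits arguments, so relations given in a fixed
  argument order can be combined freely.\<close>

lemma definable_rel_pullback:
  assumes "definable_rel n R" "length ix = n" "set ix \<subseteq> {..<k}"
  shows "definable_rel k (\<lambda>bs. R (map ((!) bs) ix))"
proof -
  obtain \<phi> cs where \<phi>: "wf_fm L \<phi>" "set cs \<subseteq> univ M" "fv \<phi> \<subseteq> {..<n * d + length cs}"
      "\<And>bs. length bs = n \<Longrightarrow> set bs \<subseteq> tuples M d \<Longrightarrow> R bs \<longleftrightarrow> sat_tup M \<phi> (concat bs @ cs)"
    using assms(1) by (auto simp: definable_rel_def)
  \<comment> \<open>Variable \<open>v\<close> stands for entry \<open>v mod d\<close> of argument
    number \<open>v div d\<close>; the argument number is sent through \<open>ix\<close>, while the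
    parameters shift to the new end.\<close>
  define \<rho> where "\<rho> v = (if v < n * d then ix ! (v div d) * d + v mod d else v - n * d + k * d)" for v
  have ix: "ix ! (v div d) < k" "v mod d < d" if "v < n * d" for v
  proof -
    have "d > 0" using that by (auto intro: Nat.gr0I)
    then have "v div d < n" using that by (simp add: less_mult_imp_div_less)
    then have "ix ! (v div d) \<in> set ix" using assms(2) by simp
    then show "ix ! (v div d) < k" using assms(3) by auto
    show "v mod d < d" using \<open>d > 0\<close> by simp
  qed
  have lt: "ix ! (v div d) * d + v mod d < k * d" if "v < n * d" for v
  proof -
    have "ix ! (v div d) * d + v mod d < Suc (ix ! (v div d)) * d" using ix[OF that] by simp
    also have "\<dots> \<le> k * d" using ix[OF that] by (intro mult_le_mono1) simp
    finally show ?thesis .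
  qed
  have "\<rho> ` fv \<phi> \<subseteq> {..<k * d + length cs}"
  proof clarsimp
    fix v assume "v \<in> fv \<phi>"
    then have "v < n * d + length cs" using \<phi>(3) by auto
    then show "\<rho> v < k * d + length cs"
      using lt[of v] by (cases "v < n * d") (auto simp: \<rho>_def)
  qed
  then have "fv (rename \<rho> \<phi>) \<subseteq> {..<k * d + length cs}" by (rule order_trans[OF fv_rename])
  moreover have "R (map ((!) bs) ix) \<longleftrightarrow> sat_tup M (rename \<rho> \<phi>) (concat bs @ cs)"
    if bs: "length bs = k" "set bs \<subseteq> tuples M d" for bs
  proof -
    have ixb: "length (map ((!) bs) ix) = n" "set (map ((!) bs) ix) \<subseteq> tuples M d"
      using assms(2,3) bs by (auto simp: subset_iff)
    have len: "length (concat bs) = k * d" "length (concat (map ((!) bs) ix)) = n * d"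
      using length_concat_tuples[OF bs(2)] length_concat_tuples[OF ixb(2)] bs ixb by simp_all
    have "sat_tup M (rename \<rho> \<phi>) (concat bs @ cs) = sat_tup M \<phi> (concat (map ((!) bs) ix) @ cs)"
    proof (rule sat_tup_rename)
      fix v assume "v \<in> fv \<phi>"
      then have v: "v < n * d + length cs" using \<phi>(3) by auto
      show "(concat bs @ cs) ! \<rho> v = (concat (map ((!) bs) ix) @ cs) ! v"
      proof (cases "v < n * d")
        case True
        then have "v div d < n" by (simp add: less_mult_imp_div_less)
        moreover have "(ix ! (v div d) * d + v mod d) div d = ix ! (v div d)"
          "(ix ! (v div d) * d + v mod d) mod d = v mod d" using ix[OF True] by simp_all
        ultimately show ?thesis
          using True lt[OF True] nth_concat_tuples[OF bs(2), of "ix ! (v div d) * d + v mod d"]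
            nth_concat_tuples[OF ixb(2), of v] bs(1) ixb(1) assms(2)
          by (simp add: \<rho>_def nth_append len)
      next
        case False
        then obtain w where "v = n * d + w" using le_Suc_ex not_less by blast
        then show ?thesis by (simp add: \<rho>_def nth_append len)
      qed
    qed
    then show ?thesis using \<phi>(4)[OF ixb] by simp
  qed
  ultimately show ?thesis
    unfolding definable_rel_def using \<phi>(1,2)
    by (intro exI[of _ "rename \<rho> \<phi>"] exI[of _ cs]) auto
qed

lemma definable_rel_ex:
  assumes "definable_rel (Suc k) R"
  shows "definable_rel k (\<lambda>bs. \<exists>b \<in> tuples M d. R (bs @ [b]))"
proof -
  obtain \<phi> cs where \<phi>: "wf_fm L \<phi>" "set cs \<subseteq> univ M" "fv \<phi> \<subseteq> {..<Suc k * d + length cs}"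
      "\<And>bs. length bs = Suc k \<Longrightarrow> set bs \<subseteq> tuples M d \<Longrightarrow> R bs \<longleftrightarrow> sat_tup M \<phi> (concat bs @ cs)"
    using assms by (auto simp: definable_rel_def)
  define l where "l = k * d + length cs"
  \<comment> \<open>\<open>Exis\<close> binds variables at the end, so the last argument is moved
    behind the parameters, which close the gap by moving down \<open>d\<close> places.\<close>
  define \<rho> where "\<rho> v = (if v < k * d then v else if v < k * d + d then v + length cs else v - d)" for v
  define \<psi> where "\<psi> = Exis l d (rename \<rho> \<phi>)"
  have "\<rho> ` fv \<phi> \<subseteq> {..<l + d}"
    using \<phi>(3) by (fastforce simp: \<rho>_def l_def subset_iff)
  then have fv\<rho>: "fv (rename \<rho> \<phi>) \<subseteq> {..<l + d}" by (rule order_trans[OF fv_rename])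
  then have "fv \<psi> \<subseteq> {..<l}" by (auto simp: \<psi>_def fv_Exis subset_iff)
  moreover have "(\<exists>b \<in> tuples M d. R (bs @ [b])) \<longleftrightarrow> sat_tup M \<psi> (concat bs @ cs)"
    if bs: "length bs = k" "set bs \<subseteq> tuples M d" for bs
  proof -
    have len: "length (concat bs) = k * d" using length_concat_tuples bs by simp
    then have "length (concat bs @ cs) = l" by (simp add: l_def)
    then have "sat_tup M \<psi> (concat bs @ cs)
        \<longleftrightarrow> (\<exists>b \<in> tuples M d. sat_tup M (rename \<rho> \<phi>) ((concat bs @ cs) @ b))"
      using sat_tup_Exis[of "rename \<rho> \<phi>" "concat bs @ cs" d M] fv\<rho> by (simp add: \<psi>_def)
    moreover have "sat_tup M (rename \<rho> \<phi>) ((concat bs @ cs) @ b) \<longleftrightarrow> R (bs @ [b])"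
      if b: "b \<in> tuples M d" for b
    proof -
      have "length b = d" using b by (simp add: tuples_def)
      then have "sat_tup M (rename \<rho> \<phi>) ((concat bs @ cs) @ b)
          = sat_tup M \<phi> (concat (bs @ [b]) @ cs)"
        using \<phi>(3) len
        by (intro sat_tup_rename) (auto simp: \<rho>_def nth_append subset_iff add.commute)
      then show ?thesis using \<phi>(4)[of "bs @ [b]"] bs b by simp
    qed
    ultimately show ?thesis by blast
  qed
  ultimately show ?thesis
    unfolding definable_rel_def using \<phi>(1,2)
    by (intro exI[of _ \<psi>] exI[of _ cs]) (auto simp: \<psi>_def l_def)
qed

end

section \<open>Fields of positive characteristic\<close>

lemma (in cring) binomial:
  assumes "x \<in> carrier R" "y \<in> carrier R"
  shows "(x \<oplus> y) [^] (n :: nat) = (\<Oplus>k\<in>{..n}. [(n choose k)] \<cdot> (x [^] k \<otimes> y [^] (n - k)))"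
proof (induction n)
  case 0
  then show ?case using assms by simp
next
  case (Suc n)
  \<comment> \<open>Both partial products are written in the same monomials \<open>T k\<close>, so
    that their coefficients add up by Pascal's rule; the second leaves \<open>y [^] Suc n\<close>
    over.\<close>
  define T where "T k = x [^] Suc k \<otimes> y [^] (n - k)" for k
  have T: "T k \<in> carrier R" for k using assms by (simp add: T_def)
  have X: "(\<Oplus>k\<in>{..n}. [(n choose k)] \<cdot> (x [^] k \<otimes> y [^] (n - k))) \<otimes> x
      = (\<Oplus>k\<in>{..n}. [(n choose k)] \<cdot> T k)"
    using assms by (subst finsum_ldistr)
      (auto intro!: finsum_cong' simp: T_def add_pow_ldistr add_pow_rdistr m_ac)
  have Y: "(\<Oplus>k\<in>{..n}. [(n choose k)] \<cdot> (x [^] k \<otimes> y [^] (n - k))) \<otimes> y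
      = (\<Oplus>k\<in>{..n}. [(n choose Suc k)] \<cdot> T k) \<oplus> y [^] Suc n"
  proof -
    have "(\<Oplus>k\<in>{..n}. [(n choose k)] \<cdot> (x [^] k \<otimes> y [^] (n - k))) \<otimes> y
        = (\<Oplus>k\<in>{..n}. [(n choose k)] \<cdot> (x [^] k \<otimes> y [^] (Suc n - k)))"
      using assms by (subst finsum_ldistr)
        (auto intro!: finsum_cong' simp: add_pow_ldistr add_pow_rdistr m_assoc Suc_diff_le)
    also have "\<dots> = (\<Oplus>k\<in>{..Suc n}. [(n choose k)] \<cdot> (x [^] k \<otimes> y [^] (Suc n - k)))"
      using assms by (subst finsum_Suc) (auto simp: binomial_eq_0 simp del: nat_pow_Suc)
    also have "\<dots> = (\<Oplus>k\<in>{..n}. [(n choose Suc k)] \<cdot> T k) \<oplus> y [^] Suc n"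
      using assms by (subst finsum_Suc2) (auto simp: T_def simp del: nat_pow_Suc)
    finally show ?thesis .
  qed
  have "(x \<oplus> y) [^] Suc n = (x \<oplus> y) [^] n \<otimes> x \<oplus> (x \<oplus> y) [^] n \<otimes> y"
    using assms by (simp add: r_distr)
  also have "\<dots> = (\<Oplus>k\<in>{..n}. [(n choose k)] \<cdot> T k)
      \<oplus> ((\<Oplus>k\<in>{..n}. [(n choose Suc k)] \<cdot> T k) \<oplus> y [^] Suc n)"
    by (simp only: Suc X Y)
  also have "\<dots> = (\<Oplus>k\<in>{..n}. [(Suc n choose Suc k)] \<cdot> T k) \<oplus> y [^] Suc n"
    using assms T by (simp add: a_assoc[symmetric] finsum_addf[symmetric] add.nat_pow_mult del: nat_pow_Suc)
  also have "\<dots> = (\<Oplus>k\<in>{..Suc n}. [(Suc n choose k)] \<cdot> (x [^] k \<otimes> y [^] (Suc n - k)))"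
    using assms by (subst finsum_Suc2) (auto simp: T_def simp del: nat_pow_Suc)
  finally show ?case .
qed

locale char_p_field = field R for R (structure) +
  fixes p :: nat
  assumes char: "has_characteristic R p" and p_pos: "p > 0"
begin

lemma of_nat_eq_zero_iff: "[n] \<cdot> \<one> = \<zero> \<longleftrightarrow> p dvd n"
  using char by (simp add: has_characteristic_def)

text \<open>The multiples of one multiply like integers, so the absence of zero divisors in the
  field makes \<open>p\<close> prime.\<close>

lemma prime_p: "Factorial_Ring.prime p"
proof -
  have "\<not> p dvd 1" using of_nat_eq_zero_iff[of 1] by simp
  then have "p \<noteq> 1" by auto
  moreover have "p dvd a \<or> p dvd b" if "p dvd a * b" for a b
  proof -
    have "([a] \<cdot> \<one>) \<otimes> ([b] \<cdot> \<one>) = [(a * b)] \<cdot> \<one>"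
      by (simp add: add_pow_ldistr add.nat_pow_pow mult.commute)
    also have "\<dots> = \<zero>" using that by (simp add: of_nat_eq_zero_iff)
    finally show ?thesis by (simp add: integral_iff of_nat_eq_zero_iff)
  qed
  ultimately have "prime_elem p"
    unfolding prime_elem_def using p_pos by (metis nat_dvd_1_iff_1 not_gr_zero)
  then show ?thesis unfolding normalization_semidom_class.prime_def by simp
qed

lemma p_gt_1: "p > 1" by (rule prime_gt_1_nat[OF prime_p])

lemma add_pow_dvd_zero:
  assumes "x \<in> carrier R" "p dvd n" shows "[n] \<cdot> x = \<zero>"
proof -
  have "[n] \<cdot> x = ([n] \<cdot> \<one>) \<otimes> x" using assms by (simp add: add_pow_ldistr)
  moreover have "[n] \<cdot> \<one> = \<zero>" using assms by (simp add: of_nat_eq_zero_iff)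
  ultimately show ?thesis using assms by simp
qed

lemma pow_eq_zeroD: "x \<in> carrier R \<Longrightarrow> x [^] (n :: nat) = \<zero> \<Longrightarrow> x = \<zero>"
  by (induction n) (auto simp: integral_iff)

lemma frob_add:
  assumes "x \<in> carrier R" "y \<in> carrier R"
  shows "(x \<oplus> y) [^] p = x [^] p \<oplus> y [^] p"
proof -
  \<comment> \<open>With \<open>p\<close> a double successor, the first and last binomial terms can
    be split off; the indices between are \<open>Suc k\<close> for k \<le> q, where \<open>p\<close>
    divides the coefficient.\<close>
  define q where "q = p - 2"
  have q: "p = Suc (Suc q)" using p_gt_1 by (simp add: q_def)
  define T where "T k = [(p choose k)] \<cdot> (x [^] k \<otimes> y [^] (p - k))" for k
  have T: "T k \<in> carrier R" for k using assms by (simp add: T_def)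
  have T0: "T (Suc k) = \<zero>" if "k \<le> q" for k
  proof -
    have "p dvd p choose Suc k"
      using prime_p that q by (intro dvd_choose_prime) auto
    then show ?thesis using assms by (simp add: T_def add_pow_dvd_zero del: nat_pow_Suc)
  qed
  have "(x \<oplus> y) [^] p = (\<Oplus>k\<in>{..Suc (Suc q)}. T k)"
    using binomial[OF assms, of p] by (simp only: T_def q)
  also have "\<dots> = T (Suc (Suc q)) \<oplus> ((\<Oplus>k\<in>{..q}. T (Suc k)) \<oplus> T 0)"
    using T by (subst finsum_Suc, simp, subst finsum_Suc2) auto
  also have "(\<Oplus>k\<in>{..q}. T (Suc k)) = \<zero>"
    using T0 by (intro add.finprod_one_eqI) auto
  also have "T 0 = y [^] p" using assms by (simp add: T_def)
  also have "T (Suc (Suc q)) = x [^] p" using assms by (simp add: T_def q[symmetric])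
  finally show ?thesis using assms by simp
qed

lemma frob_minus:
  assumes "x \<in> carrier R" shows "(\<ominus> x) [^] p = \<ominus> (x [^] p)"
proof -
  have "(\<ominus> x) [^] p \<oplus> x [^] p = (\<ominus> x \<oplus> x) [^] p" using assms by (simp add: frob_add)
  also have "\<dots> = \<zero>" using assms p_pos by (simp add: l_neg nat_pow_zero)
  finally show ?thesis using assms by (intro minus_equality[symmetric]) auto
qed

lemma frob_diff:
  "x \<in> carrier R \<Longrightarrow> y \<in> carrier R \<Longrightarrow> (x \<ominus> y) [^] p = x [^] p \<ominus> y [^] p"
  by (simp add: minus_eq frob_add frob_minus)

lemma frob_inj:
  assumes "x \<in> carrier R" "y \<in> carrier R" "x [^] p = y [^] p" shows "x = y"
proof -
  have "(x \<ominus> y) [^] p = \<zero>" using assms by (simp add: frob_diff r_right_minus_eq)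
  then have "x \<ominus> y = \<zero>" using assms by (metis minus_closed pow_eq_zeroD)
  then show ?thesis using assms by (simp add: r_right_minus_eq)
qed

lemma eval_replicate_zero:
  "x \<in> carrier R \<Longrightarrow> set q \<subseteq> carrier R \<Longrightarrow> eval (replicate n \<zero> @ q) x = eval q x"
  by (induction n) (auto simp: eval_in_carrier)

lemma card_frob_fixed:
  shows "finite {z \<in> carrier R. z [^] p = z}" "card {z \<in> carrier R. z [^] p = z} \<le> p"
proof -
  \<comment> \<open>The coefficient list of X^p - X, leading coefficient first.\<close>
  define P where "P = \<one> # (replicate (p - 2) \<zero> @ [\<ominus> \<one>, \<zero>])"
  have P: "P \<in> carrier (poly_ring R)"
    unfolding univ_poly_carrier[symmetric] polynomial_def P_def by auto
  have len: "length P = Suc p" using p_gt_1 by (simp add: P_def)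
  have "is_root P z" if "z \<in> carrier R" "z [^] p = z" for z
  proof -
    have "length (replicate (p - 2) \<zero> @ [\<ominus> \<one>, \<zero>]) = p" using p_gt_1 by simp
    then have "eval P z = z [^] p \<oplus> eval [\<ominus> \<one>, \<zero>] z"
      using that(1) p_gt_1 eval_replicate_zero[of z "[\<ominus> \<one>, \<zero>]" "p - 2"]
      by (simp only: P_def eval.simps list.sel list.case) simp
    also have "\<dots> = \<zero>" using that by (simp add: l_minus r_neg)
    finally show ?thesis using that by (simp add: is_root_def P_def)
  qed
  then have sub: "{z \<in> carrier R. z [^] p = z} \<subseteq> set_mset (roots P)"
    using roots_mem_iff_is_root[OF P] by auto
  then show "finite {z \<in> carrier R. z [^] p = z}" by (rule finite_subset) simp
  have "card {z \<in> carrier R. z [^] p = z} \<le> card (set_mset (roots P))"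
    using sub by (intro card_mono) auto
  also have "\<dots> \<le> size (roots P)" by (metis mset_set_set_mset_msubset size_mset_mono size_mset_set)
  also have "\<dots> \<le> p" using size_roots_le_degree[OF P] len by simp
  finally show "card {z \<in> carrier R. z [^] p = z} \<le> p" .
qed

lemma frob_of_nat: "([(n :: nat)] \<cdot> \<one>) [^] p = [n] \<cdot> \<one>"
proof (induction n)
  case 0
  then show ?case using p_pos by (simp add: nat_pow_zero)
next
  case (Suc n)
  then show ?case by (simp add: frob_add)
qed

text \<open>X^p - X has at most \<open>p\<close> roots, and the prime field already supplies
  \<open>p\<close> of them.\<close>

lemma frob_fixed_eq: "{z \<in> carrier R. z [^] p = z} = (\<lambda>n. [n] \<cdot> \<one>) ` {..<p}"
proof (rule card_seteq[symmetric])
  have "inj_on (\<lambda>n. [n] \<cdot> \<one>) {..<p}"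
  proof (rule linorder_inj_onI')
    fix i j assume ij: "i \<in> {..<p}" "j \<in> {..<p}" "i < j"
    show "[i] \<cdot> \<one> \<noteq> [j] \<cdot> \<one>"
    proof
      assume eq: "[i] \<cdot> \<one> = [j] \<cdot> \<one>"
      have "[j] \<cdot> \<one> = [i] \<cdot> \<one> \<oplus> [(j - i)] \<cdot> \<one>" using ij by (simp add: add.nat_pow_mult)
      then have "[(j - i)] \<cdot> \<one> = \<zero>" using eq by (simp add: add.nat_pow_closed)
      then have "p dvd j - i" by (simp add: of_nat_eq_zero_iff)
      then show False using ij by (auto dest: dvd_imp_le)
    qed
  qed
  then show "card {z \<in> carrier R. z [^] p = z} \<le> card ((\<lambda>n. [n] \<cdot> \<one>) ` {..<p})"
    using card_frob_fixed(2) by (simp add: card_image)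
qed (auto simp: frob_of_nat card_frob_fixed)

section \<open>The additive map x^p - x and its image\<close>

definition wp :: "'a \<Rightarrow> 'a" where
  "wp x = x [^] p \<ominus> x"

definition WP :: "'a set" where
  "WP = wp ` carrier R"

lemma wp_closed [simp]: "x \<in> carrier R \<Longrightarrow> wp x \<in> carrier R"
  by (simp add: wp_def)

lemma wp_add: "x \<in> carrier R \<Longrightarrow> y \<in> carrier R \<Longrightarrow> wp (x \<oplus> y) = wp x \<oplus> wp y"
  unfolding wp_def by (simp add: frob_add) (simp add: minus_eq minus_add a_ac)

lemma wp_minus: "x \<in> carrier R \<Longrightarrow> wp (\<ominus> x) = \<ominus> wp x"
  unfolding wp_def by (simp add: frob_minus minus_eq minus_add)

lemma wp_in_WP [simp]: "x \<in> carrier R \<Longrightarrow> wp x \<in> WP"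
  by (simp add: WP_def)

lemma WP_closed [simp]: "x \<in> WP \<Longrightarrow> x \<in> carrier R"
  by (auto simp: WP_def)

lemma WP_add: "x \<in> WP \<Longrightarrow> y \<in> WP \<Longrightarrow> x \<oplus> y \<in> WP"
  by (auto simp: WP_def wp_add[symmetric])

lemma WP_minus: "x \<in> WP \<Longrightarrow> \<ominus> x \<in> WP"
  by (auto simp: WP_def wp_minus[symmetric])

lemma WP_diff: "x \<in> WP \<Longrightarrow> y \<in> WP \<Longrightarrow> x \<ominus> y \<in> WP"
  by (simp add: minus_eq WP_add WP_minus)

lemma WP_zero: "\<zero> \<in> WP"
proof -
  have "wp \<zero> = \<zero>" using p_pos by (simp add: wp_def nat_pow_zero)
  then show ?thesis by (metis wp_in_WP zero_closed)
qed

lemma WP_diff_mem_iff: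
  assumes "x \<ominus> y \<in> WP" "x \<in> carrier R" "y \<in> carrier R" shows "x \<in> WP \<longleftrightarrow> y \<in> WP"
proof
  assume "x \<in> WP"
  have "x \<ominus> (x \<ominus> y) \<in> WP" using \<open>x \<in> WP\<close> assms(1) by (rule WP_diff)
  moreover have "x \<ominus> (x \<ominus> y) = y" using assms(2,3) by algebra
  ultimately show "y \<in> WP" by metis
next
  assume "y \<in> WP"
  then have "(x \<ominus> y) \<oplus> y \<in> WP" using assms by (intro WP_add)
  moreover have "(x \<ominus> y) \<oplus> y = x" using assms(2,3) by algebra
  ultimately show "x \<in> WP" by (simp only:)
qed

text \<open>A nonempty fibre of an additive map is a translate of its kernel, here the set of fixed
  points of the Frobenius map.\<close>

lemma card_frob_fibre:
  assumes "v \<in> carrier R"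
  shows "finite {r \<in> carrier R. r \<ominus> r [^] p = v} \<and> card {r \<in> carrier R. r \<ominus> r [^] p = v} \<le> p"
proof (cases "{r \<in> carrier R. r \<ominus> r [^] p = v} = {}")
  case False
  then obtain s where s: "s \<in> carrier R" "s \<ominus> s [^] p = v" by blast
  have inj: "inj_on (\<lambda>r. r \<ominus> s) {r \<in> carrier R. r \<ominus> r [^] p = v}"
  proof (rule inj_onI)
    fix x y assume "x \<in> {r \<in> carrier R. r \<ominus> r [^] p = v}" "y \<in> {r \<in> carrier R. r \<ominus> r [^] p = v}"
      and "x \<ominus> s = y \<ominus> s"
    then show "x = y" using s by (simp add: minus_eq)
  qed
  have sub: "(\<lambda>r. r \<ominus> s) ` {r \<in> carrier R. r \<ominus> r [^] p = v} \<subseteq> {z \<in> carrier R. z [^] p = z}"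
  proof
    fix z assume "z \<in> (\<lambda>r. r \<ominus> s) ` {r \<in> carrier R. r \<ominus> r [^] p = v}"
    then obtain r where r: "r \<in> carrier R" "r \<ominus> r [^] p = v" and z: "z = r \<ominus> s" by blast
    have "r \<ominus> r [^] p \<ominus> (s \<ominus> s [^] p) = \<zero>" using r s assms by (simp add: r_right_minus_eq)
    moreover have "r \<ominus> r [^] p \<ominus> (s \<ominus> s [^] p) = (r \<ominus> s) \<ominus> (r [^] p \<ominus> s [^] p)"
      using r(1) s(1) nat_pow_closed[of r p] nat_pow_closed[of s p] by algebra
    ultimately have "(r \<ominus> s) \<ominus> (r [^] p \<ominus> s [^] p) = \<zero>" by simp
    then have "r \<ominus> s = r [^] p \<ominus> s [^] p" using r s by (simp add: r_right_minus_eq)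
    then show "z \<in> {z \<in> carrier R. z [^] p = z}"
      unfolding z using frob_diff[of r s] r(1) s(1) by simp
  qed
  show ?thesis
    using finite_imageD[OF finite_subset[OF sub card_frob_fixed(1)] inj]
      card_mono[OF card_frob_fixed(1) sub] card_frob_fixed(2) card_image[OF inj] by simp
next
  case True
  then show ?thesis by (simp only: True) simp
qed

end

section \<open>Intersections of scaled Artin--Schreier groups\<close>

context char_p_field
begin

text \<open>The subfield of p^n-th powers. The index records how many successive p-th roots can
  still be taken inside K.\<close>

primrec frob_range :: "nat \<Rightarrow> 'a set" where
  "frob_range 0 = carrier R"
| "frob_range (Suc n) = (\<lambda>x. x [^] p) ` frob_range n"

lemma frob_range_carrier: "x \<in> frob_range n \<Longrightarrow> x \<in> carrier R"
  by (induction n arbitrary: x) auto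

lemma frob_range_Suc_subset: "frob_range (Suc n) \<subseteq> frob_range n"
  by (induction n) auto

lemma frob_range_diff: "x \<in> frob_range n \<Longrightarrow> y \<in> frob_range n \<Longrightarrow> x \<ominus> y \<in> frob_range n"
proof (induction n arbitrary: x y)
  case (Suc n)
  then obtain a b where "a \<in> frob_range n" "b \<in> frob_range n" "x = a [^] p" "y = b [^] p" by auto
  then have "x \<ominus> y = (a \<ominus> b) [^] p" "a \<ominus> b \<in> frob_range n"
    using Suc.IH by (simp_all add: frob_diff frob_range_carrier)
  then show ?case by simp
qed simp

lemma frob_range_mult_inv: "x \<in> frob_range n \<Longrightarrow> y \<in> frob_range n \<Longrightarrow> y \<noteq> \<zero> \<Longrightarrow> x \<otimes> inv y \<in> frob_range n"
proof (induction n arbitrary: x y)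
  case 0
  then show ?case by (simp add: field_Units)
next
  case (Suc n)
  then obtain a b where ab: "a \<in> frob_range n" "b \<in> frob_range n" "x = a [^] p" "y = b [^] p" by auto
  then have carr: "a \<in> carrier R" "b \<in> carrier R" by (auto intro: frob_range_carrier)
  have b: "b \<noteq> \<zero>" using Suc.prems ab p_pos by (auto simp: nat_pow_zero)
  then have u: "b \<in> Units R" using carr by (simp add: field_Units)
  have "inv (b [^] p) = (inv b) [^] p"
  proof (rule comm_inv_char)
    have "b [^] p \<otimes> inv b [^] p = (b \<otimes> inv b) [^] p"
      using carr u by (intro nat_pow_distrib[symmetric]) auto
    then show "b [^] p \<otimes> inv b [^] p = \<one>" using u by simp
  qed (use carr u in auto)
  then have "x \<otimes> inv y = (a \<otimes> inv b) [^] p" using ab carr u by (simp add: nat_pow_distrib)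
  moreover have "a \<otimes> inv b \<in> frob_range n" using Suc.IH ab b by blast
  ultimately show ?case by simp
qed

lemma infinite_frob_range: "infinite (carrier R) \<Longrightarrow> infinite (frob_range n)"
proof (induction n)
  case (Suc n)
  have "inj_on (\<lambda>x. x [^] p) (frob_range n)"
    by (rule inj_onI) (auto intro: frob_inj frob_range_carrier)
  then show ?case using Suc by (simp add: finite_image_iff)
qed simp

definition S :: "'a set \<Rightarrow> 'a set" where
  "S B = {t \<in> carrier R. \<forall>w \<in> B. w \<otimes> t \<in> WP}"

text \<open>
  \<open>d\<close> is the adjoint of the parametrisation \<open>f\<close> with respect to the pairing \<open>(w, t) \<mapsto> w t\<close> modulo
  \<open>\<wp>(K)\<close>. As \<open>u\<^sup>p\<close> and \<open>u\<close> are congruent, the adjoint of the Frobenius is its inverse, whence the loss of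
  one level of \<open>p\<close>-th powers for each element of \<open>B\<close>.
\<close>

definition parametrises :: "nat \<Rightarrow> 'a set \<Rightarrow> ('a \<Rightarrow> 'a) \<Rightarrow> ('a \<Rightarrow> 'a) \<Rightarrow> bool" where
  "parametrises N B f d \<longleftrightarrow>
     (\<forall>x \<in> carrier R. \<forall>y \<in> carrier R. f (x \<oplus> y) = f x \<oplus> f y) \<and>
     f ` carrier R = S B \<and>
     (\<forall>w \<in> frob_range N. d w \<in> frob_range (N - card B) \<and> (\<forall>y \<in> carrier R. w \<otimes> f y \<ominus> d w \<otimes> y \<in> WP)) \<and>
     (\<forall>v \<in> carrier R. finite {w \<in> frob_range N. d w = v} \<and> card {w \<in> frob_range N. d w = v} \<le> p ^ card B)"

text \<open>Along \<open>f\<close>, the new condition for \<open>w0\<close> becomes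
  \<open>d w0 \<otimes> y \<in> WP\<close>. If \<open>d w0\<close> is zero it is vacuous; otherwise
  its solutions are the multiples \<open>e \<otimes> wp x\<close> with \<open>e\<close> the inverse
  of \<open>d w0\<close>, and composing \<open>f\<close> with this map parametrises the smaller
  group.\<close>

lemma parametrisation_ex:
  assumes "finite B" "B \<subseteq> frob_range N" "card B \<le> N"
  shows "\<exists>f d. parametrises N B f d"
  using assms
proof (induction B rule: finite_induct)
  case empty
  have "w \<otimes> y \<ominus> w \<otimes> y \<in> WP" if "w \<in> carrier R" "y \<in> carrier R" for w y
  proof -
    have "w \<otimes> y \<ominus> w \<otimes> y = \<zero>" using that by (simp add: r_right_minus_eq)
    then show ?thesis by (simp only: WP_zero)
  qed
  moreover have "{w \<in> frob_range N. w = v} \<subseteq> {v}" for v by auto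
  then have "finite {w \<in> frob_range N. w = v} \<and> card {w \<in> frob_range N. w = v} \<le> 1" for v
    using finite_subset[of _ "{v}"] card_mono[of "{v}"] by auto
  ultimately have "parametrises N {} (\<lambda>y. y) (\<lambda>w. w)"
    by (auto simp: parametrises_def S_def intro: frob_range_carrier)
  then show ?case by blast
next
  case (insert w0 B)
  then obtain f d where "parametrises N B f d" by auto
  then have f_add: "\<And>x y. x \<in> carrier R \<Longrightarrow> y \<in> carrier R \<Longrightarrow> f (x \<oplus> y) = f x \<oplus> f y"
    and f_image: "f ` carrier R = S B"
    and d_frob_range: "\<And>w. w \<in> frob_range N \<Longrightarrow> d w \<in> frob_range (N - card B)"
    and adj: "\<And>w y. w \<in> frob_range N \<Longrightarrow> y \<in> carrier R \<Longrightarrow> w \<otimes> f y \<ominus> d w \<otimes> y \<in> WP"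
    and fibre: "\<And>v. v \<in> carrier R \<Longrightarrow> finite {w \<in> frob_range N. d w = v}"
      "\<And>v. v \<in> carrier R \<Longrightarrow> card {w \<in> frob_range N. d w = v} \<le> p ^ card B"
    by (auto simp: parametrises_def)
  have f_closed: "f y \<in> carrier R" if "y \<in> carrier R" for y
    using f_image that by (auto simp: S_def)
  have d_closed: "d w \<in> carrier R" if "w \<in> frob_range N" for w
    using d_frob_range[OF that] by (rule frob_range_carrier)
  have w0: "w0 \<in> frob_range N" "w0 \<in> carrier R" using insert.prems by (auto intro: frob_range_carrier)
  have mem_iff: "w0 \<otimes> f y \<in> WP \<longleftrightarrow> d w0 \<otimes> y \<in> WP" if "y \<in> carrier R" for y
    using adj[OF w0(1) that] w0 that by (intro WP_diff_mem_iff) (auto simp: f_closed d_closed)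
  have S_insert: "S (insert w0 B) = f ` {y \<in> carrier R. d w0 \<otimes> y \<in> WP}"
  proof -
    have "S (insert w0 B) = {t \<in> S B. w0 \<otimes> t \<in> WP}" by (auto simp: S_def)
    also have "\<dots> = f ` {y \<in> carrier R. d w0 \<otimes> y \<in> WP}"
      unfolding f_image[symmetric] using mem_iff by auto
    finally show ?thesis .
  qed
  have card: "card (insert w0 B) = Suc (card B)" using insert by simp
  define r where "r = N - Suc (card B)"
  \<comment> \<open>The bound on the cardinality leaves at least one level here, so one more p-th
    root can be taken.\<close>
  have r: "N - card B = Suc r" using insert.prems by (simp add: r_def card)
  show ?case
  proof (cases "d w0 = \<zero>")
    case True
    have "{y \<in> carrier R. d w0 \<otimes> y \<in> WP} = carrier R" using True WP_zero by auto
    then have "f ` carrier R = S (insert w0 B)" by (simp add: S_insert)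
    moreover have "d w \<in> frob_range r" if "w \<in> frob_range N" for w
      using d_frob_range[OF that] frob_range_Suc_subset[of r] by (auto simp only: r)
    moreover have "card {w \<in> frob_range N. d w = v} \<le> p ^ Suc (card B)" if "v \<in> carrier R" for v
      using fibre(2)[OF that] by (rule order_trans) (use p_pos in simp)
    ultimately have "parametrises N (insert w0 B) f d"
      unfolding parametrises_def card r_def[symmetric]
      using f_add adj fibre(1) by blast
    then show ?thesis by blast
  next
    case False
    define e where "e = inv (d w0)"
    have dw0: "d w0 \<in> carrier R" "d w0 \<in> Units R" using False w0 by (auto simp: d_closed field_Units)
    have e: "e \<in> carrier R" "d w0 \<otimes> e = \<one>" using dw0 by (auto simp: e_def)
    \<comment> \<open>The quotient of \<open>d w\<close> by \<open>d w0\<close> stays in level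
      \<open>Suc r\<close>, a subfield, and is therefore the p-th power of an element of level
      \<open>r\<close>.\<close>
    have "\<exists>b \<in> frob_range r. b [^] p = d w \<otimes> e" if "w \<in> frob_range N" for w
      using frob_range_mult_inv[of "d w" "Suc r" "d w0"] d_frob_range[OF that] d_frob_range[OF w0(1)] False
      by (auto simp: r e_def)
    then obtain \<rho> where \<rho>: "\<And>w. w \<in> frob_range N \<Longrightarrow> \<rho> w \<in> frob_range r \<and> \<rho> w [^] p = d w \<otimes> e" by metis
    have \<rho>_closed: "\<rho> w \<in> carrier R" if "w \<in> frob_range N" for w using \<rho>[OF that] frob_range_carrier by blast
    define f' where "f' y = f (e \<otimes> wp y)" for y
    define d' where "d' w = \<rho> w \<ominus> \<rho> w [^] p" for w
    have "f' (x \<oplus> y) = f' x \<oplus> f' y" if "x \<in> carrier R" "y \<in> carrier R" for x y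
      using that e by (simp add: f'_def wp_add r_distr f_add)
    moreover have "f' ` carrier R = S (insert w0 B)"
    proof -
      have "{y \<in> carrier R. d w0 \<otimes> y \<in> WP} = (\<lambda>y. e \<otimes> wp y) ` carrier R"
      proof (intro equalityI subsetI)
        fix y assume "y \<in> {y \<in> carrier R. d w0 \<otimes> y \<in> WP}"
        then obtain x where x: "y \<in> carrier R" "x \<in> carrier R" "d w0 \<otimes> y = wp x"
          by (auto simp: WP_def)
        have "y = (d w0 \<otimes> e) \<otimes> y" using e x by simp
        also have "\<dots> = e \<otimes> (d w0 \<otimes> y)" using e(1) dw0(1) x(1) by algebra
        finally show "y \<in> (\<lambda>y. e \<otimes> wp y) ` carrier R" using x by auto
      next
        fix y assume "y \<in> (\<lambda>y. e \<otimes> wp y) ` carrier R"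
        then obtain x where x: "x \<in> carrier R" "y = e \<otimes> wp x" by auto
        have "d w0 \<otimes> y = wp x" using x e dw0(1) by (simp add: m_assoc[symmetric])
        then show "y \<in> {y \<in> carrier R. d w0 \<otimes> y \<in> WP}" using x e by simp
      qed
      then show ?thesis by (simp add: S_insert f'_def image_image)
    qed
    moreover have "d' w \<in> frob_range r" if "w \<in> frob_range N" for w
      using \<rho>[OF that] frob_range_Suc_subset[of r] unfolding d'_def by (intro frob_range_diff) auto
    moreover have "w \<otimes> f' y \<ominus> d' w \<otimes> y \<in> WP" if w: "w \<in> frob_range N" and y: "y \<in> carrier R" for w y
    proof -
      have wc: "w \<in> carrier R" using w by (rule frob_range_carrier)
      define u where "u = f (e \<otimes> wp y)"
      have u: "u \<in> carrier R" using e y by (simp add: u_def f_closed)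
      have 1: "w \<otimes> u \<ominus> d w \<otimes> (e \<otimes> wp y) \<in> WP"
        unfolding u_def using e y by (intro adj w) auto
      \<comment> \<open>Adding this element replaces \<open>\<rho> w [^] p \<otimes> y [^] p\<close>
        by \<open>\<rho> w \<otimes> y\<close>, which turns the expression into one linear in
        \<open>y\<close> and gives the formula for \<open>d'\<close>.\<close>
      have 2: "wp (\<rho> w \<otimes> y) \<in> WP" using \<rho>_closed[OF w] y by simp
      have "d w \<otimes> (e \<otimes> wp y) = \<rho> w [^] p \<otimes> wp y"
        using \<rho>[OF w] d_closed[OF w] e y by (simp add: m_assoc)
      then have "(w \<otimes> u \<ominus> d w \<otimes> (e \<otimes> wp y)) \<oplus> wp (\<rho> w \<otimes> y)
          = (w \<otimes> u \<ominus> \<rho> w [^] p \<otimes> (y [^] p \<ominus> y)) \<oplus> (\<rho> w [^] p \<otimes> y [^] p \<ominus> \<rho> w \<otimes> y)"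
        using \<rho>_closed[OF w] y by (simp add: wp_def nat_pow_distrib)
      also have "\<dots> = w \<otimes> u \<ominus> (\<rho> w \<ominus> \<rho> w [^] p) \<otimes> y"
        using \<rho>_closed[OF w] y wc u nat_pow_closed[OF \<rho>_closed[OF w], of p] nat_pow_closed[OF y, of p]
        by algebra
      finally show ?thesis using WP_add[OF 1 2] by (simp add: f'_def d'_def u_def)
    qed
    moreover have "finite {w \<in> frob_range N. d' w = v} \<and> card {w \<in> frob_range N. d' w = v} \<le> p ^ Suc (card B)"
      if v: "v \<in> carrier R" for v
    proof -
      \<comment> \<open>Prescribing \<open>d' w\<close> leaves at most \<open>p\<close> values for
        \<open>\<rho> w\<close>; each of them determines \<open>d w\<close>, whose fibre obeys the
        inductive bound. This is where the exponent grows by one.\<close>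
      define Z where "Z = {s \<in> carrier R. s \<ominus> s [^] p = v}"
      have Z: "finite Z" "card Z \<le> p" using card_frob_fibre[OF v] by (auto simp: Z_def)
      define A where "A s = {w \<in> frob_range N. d w = s [^] p \<otimes> d w0}" for s
      have A: "finite (A s)" "card (A s) \<le> p ^ card B" if "s \<in> Z" for s
        using that fibre[of "s [^] p \<otimes> d w0"] dw0 by (auto simp: A_def Z_def)
      have sub: "{w \<in> frob_range N. d' w = v} \<subseteq> (\<Union>s\<in>Z. A s)"
      proof
        fix w assume "w \<in> {w \<in> frob_range N. d' w = v}"
        then have w: "w \<in> frob_range N" "d' w = v" by auto
        have "\<rho> w [^] p \<otimes> d w0 = d w \<otimes> (d w0 \<otimes> e)"
          using \<rho>[OF w(1)] d_closed[OF w(1)] e(1) dw0(1) by (simp add: m_ac)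
        then have "w \<in> A (\<rho> w)" using w e d_closed by (simp add: A_def)
        moreover have "\<rho> w \<in> Z" using w \<rho>_closed by (simp add: Z_def d'_def)
        ultimately show "w \<in> (\<Union>s\<in>Z. A s)" by blast
      qed
      have fin: "finite (\<Union>s\<in>Z. A s)" using Z A by blast
      have "card {w \<in> frob_range N. d' w = v} \<le> card (\<Union>s\<in>Z. A s)" using sub fin by (rule card_mono[rotated])
      also have "\<dots> \<le> (\<Sum>s\<in>Z. card (A s))" using Z by (intro card_UN_le)
      also have "\<dots> \<le> card Z * p ^ card B" using A sum_bounded_above[of Z "\<lambda>s. card (A s)"] by simp
      also have "\<dots> \<le> p ^ Suc (card B)" using Z by simp
      finally show ?thesis using finite_subset[OF sub fin] by simp
    qed
    ultimately have "parametrises N (insert w0 B) f' d'"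
      unfolding parametrises_def card r_def[symmetric] by blast
    then show ?thesis by blast
  qed
qed

text \<open>If \<open>d w\<close> is nonzero, \<open>d w \<otimes> y\<close> takes every value,
  including one outside \<open>WP\<close>, so \<open>w\<close> cannot map the whole of
  \<open>S B\<close> into \<open>WP\<close>.\<close>

lemma adjoint_zero_iff:
  assumes "parametrises N B f d" "w \<in> frob_range N" "WP \<noteq> carrier R"
  shows "d w = \<zero> \<longleftrightarrow> (\<forall>t \<in> S B. w \<otimes> t \<in> WP)"
proof -
  have f_image: "f ` carrier R = S B" and dw: "d w \<in> carrier R" and wc: "w \<in> carrier R"
    and adj: "\<And>y. y \<in> carrier R \<Longrightarrow> w \<otimes> f y \<ominus> d w \<otimes> y \<in> WP"
    using assms by (auto simp: parametrises_def intro: frob_range_carrier)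
  have mem_iff: "w \<otimes> f y \<in> WP \<longleftrightarrow> d w \<otimes> y \<in> WP" if "y \<in> carrier R" for y
    using adj[OF that] f_image wc dw that by (intro WP_diff_mem_iff) (auto simp: S_def)
  show ?thesis
  proof
    assume "d w = \<zero>"
    then show "\<forall>t \<in> S B. w \<otimes> t \<in> WP"
      unfolding f_image[symmetric] using mem_iff WP_zero by auto
  next
    assume *: "\<forall>t \<in> S B. w \<otimes> t \<in> WP"
    obtain c where c: "c \<in> carrier R" "c \<notin> WP" using assms(3) by (auto simp: WP_def)
    show "d w = \<zero>"
    proof (rule ccontr)
      assume "d w \<noteq> \<zero>"
      then have u: "d w \<in> Units R" using dw by (simp add: field_Units)
      then have "d w \<otimes> (inv (d w) \<otimes> c) = c" using c dw by (simp add: m_assoc[symmetric])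
      moreover have "d w \<otimes> (inv (d w) \<otimes> c) \<in> WP"
        using * c u f_image mem_iff[of "inv (d w) \<otimes> c"] by auto
      ultimately show False using c by simp
    qed
  qed
qed

text \<open>The bound on the fibres of \<open>d\<close> limits how many \<open>w\<close> can satisfy \<open>S B \<subseteq> w\<^sup>-\<^sup>1 \<wp>(K)\<close>. So a minimal \<open>B\<close>
  with \<open>S B = S W\<close> is large when \<open>W\<close> is, and by minimality no element of \<open>B\<close> is redundant.\<close>

lemma independent_scalars:
  assumes inf: "infinite (carrier R)" and ne: "WP \<noteq> carrier R"
  shows "\<exists>N B. finite B \<and> B \<subseteq> frob_range N \<and> card B \<le> N \<and> n \<le> card B \<and>
    (\<forall>w \<in> B. \<exists>t \<in> S (B - {w}). w \<otimes> t \<notin> WP)"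
proof -
  \<comment> \<open>This number is both the size of \<open>W\<close> and the level. As a size, it
    turns the fibre bound p^n \<le> p^(card B) into n \<le> card B; as a level, it covers every
    subset \<open>B\<close> of \<open>W\<close>.\<close>
  define N where "N = p ^ n"
  obtain W where W: "W \<subseteq> frob_range N" "finite W" "card W = N"
    using infinite_arbitrarily_large[OF infinite_frob_range[OF inf]] by blast
  define good where "good B \<longleftrightarrow> B \<subseteq> W \<and> S B \<subseteq> S W" for B
  have "good W" by (simp add: good_def)
  then obtain B where B: "good B" "\<And>B'. good B' \<Longrightarrow> card B \<le> card B'"
    using ex_has_least_nat[of good W card] by blast
  have BX: "B \<subseteq> W" "S B \<subseteq> S W" using B(1) by (simp_all add: good_def)
  have fin: "finite B" using BX(1) W(2) by (rule finite_subset)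
  have BN: "B \<subseteq> frob_range N" "card B \<le> N" using BX(1) W card_mono[of W B] by auto
  obtain f d where fd: "parametrises N B f d" using parametrisation_ex[OF fin BN] by blast
  have "w \<in> {w \<in> frob_range N. d w = \<zero>}" if "w \<in> W" for w
  proof -
    have w: "w \<in> frob_range N" using that W by blast
    have "\<forall>t \<in> S B. w \<otimes> t \<in> WP" using BX(2) that by (auto simp: S_def)
    then show ?thesis using adjoint_zero_iff[OF fd w ne] w by simp
  qed
  then have "card W \<le> card {w \<in> frob_range N. d w = \<zero>}"
    using fd by (intro card_mono) (auto simp: parametrises_def)
  also have "\<dots> \<le> p ^ card B" using fd by (auto simp: parametrises_def)
  finally have "n \<le> card B" using W(3) p_gt_1 by (simp add: N_def)
  moreover have "\<exists>t \<in> S (B - {w}). w \<otimes> t \<notin> WP" if w: "w \<in> B" for w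
  proof (rule ccontr)
    assume "\<not> ?thesis"
    then have "S (B - {w}) \<subseteq> S B" by (auto simp: S_def)
    then have "good (B - {w})" using BX by (auto simp: good_def)
    then show False using B(2) w fin by (metis card_Diff1_less not_less)
  qed
  ultimately show ?thesis using fin BN by blast
qed

text \<open>For each \<open>i\<close> the group attached to the other scalars is parametrised
  separately. Along that parametrisation \<open>w i\<close> acts as multiplication by the nonzero
  \<open>d (w i)\<close>, so dividing the incongruent sequence \<open>g\<close> by this element and
  mapping it into the group yields row \<open>i\<close>.\<close>

lemma dual_families:
  assumes inf: "infinite (carrier R)"
    and g: "\<forall>j. g j \<in> carrier R" "\<forall>j j' :: nat. j \<noteq> j' \<longrightarrow> g j \<ominus> g j' \<notin> WP"
  shows "\<exists>w b. (\<forall>i<n :: nat. w i \<in> carrier R) \<and> (\<forall>i<n. \<forall>j. b i j \<in> carrier R) \<and>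
    (\<forall>i<n. \<forall>l<n. l \<noteq> i \<longrightarrow> (\<forall>j :: nat. w l \<otimes> b i j \<in> WP)) \<and>
    (\<forall>i<n. \<forall>j j'. j \<noteq> j' \<longrightarrow> w i \<otimes> (b i j \<ominus> b i j') \<notin> WP)"
proof -
  have ne: "WP \<noteq> carrier R" using g(1) g(2)[rule_format, of 0 1] by auto
  obtain N B where B: "finite B" "B \<subseteq> frob_range N" "card B \<le> N" "n \<le> card B"
      "\<And>w. w \<in> B \<Longrightarrow> \<exists>t \<in> S (B - {w}). w \<otimes> t \<notin> WP"
    using independent_scalars[OF inf ne, of n] by blast
  obtain w :: "nat \<Rightarrow> 'a" where w: "bij_betw w {..<card B} B"
    using ex_bij_betw_nat_finite[OF B(1)] by (auto simp: atLeast0LessThan)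
  have wB: "w i \<in> B" if "i < n" for i using w that B(4) by (auto simp: bij_betw_def)
  then have wN: "w i \<in> frob_range N" if "i < n" for i using that B(2) by blast
  then have wc: "w i \<in> carrier R" if "i < n" for i using that frob_range_carrier by blast
  have "\<exists>b. \<forall>j :: nat. b j \<in> S (B - {w i}) \<and> (\<forall>j'. j \<noteq> j' \<longrightarrow> w i \<otimes> (b j \<ominus> b j') \<notin> WP)" if i: "i < n" for i
  proof -
    have "finite (B - {w i})" "B - {w i} \<subseteq> frob_range N" "card (B - {w i}) \<le> N"
      using B(1-3) card_Diff1_le[of B "w i"] by auto
    from parametrisation_ex[OF this] obtain f d where fd: "parametrises N (B - {w i}) f d" by blast
    have "d (w i) \<noteq> \<zero>" using adjoint_zero_iff[OF fd wN[OF i] ne] B(5)[OF wB[OF i]] by blast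
    moreover have d: "d (w i) \<in> carrier R"
      using fd wN[OF i] by (auto simp: parametrises_def intro: frob_range_carrier)
    ultimately have u: "d (w i) \<in> Units R" by (simp add: field_Units)
    define y where "y j = inv (d (w i)) \<otimes> g j" for j
    have y: "y j \<in> carrier R" for j using u g by (simp add: y_def)
    have f: "f x \<in> S (B - {w i})" "f x \<in> carrier R" if "x \<in> carrier R" for x
      using fd that by (auto simp: parametrises_def S_def)
    have f_diff: "f (y j) \<ominus> f (y j') = f (y j \<ominus> y j')" for j j'
    proof -
      have "f ((y j \<ominus> y j') \<oplus> y j') = f (y j \<ominus> y j') \<oplus> f (y j')"
        using fd y by (simp add: parametrises_def)
      moreover have "(y j \<ominus> y j') \<oplus> y j' = y j" using y[of j] y[of j'] by algebra
      ultimately have "f (y j) = f (y j \<ominus> y j') \<oplus> f (y j')" by metis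
      then show ?thesis using f(2)[OF y[of j']] f(2)[of "y j \<ominus> y j'"] y by (simp add: minus_eq a_assoc r_neg)
    qed
    have "w i \<otimes> (f (y j) \<ominus> f (y j')) \<notin> WP" if "j \<noteq> j'" for j j'
    proof -
      have dy: "d (w i) \<otimes> (y j \<ominus> y j') = g j \<ominus> g j'"
      proof -
        have "d (w i) \<otimes> (y j \<ominus> y j') = d (w i) \<otimes> y j \<ominus> d (w i) \<otimes> y j'"
          using d y[of j] y[of j'] by algebra
        moreover have "d (w i) \<otimes> y j = g j" for j
          using u d g by (simp add: y_def m_assoc[symmetric])
        ultimately show ?thesis by (simp only:)
      qed
      have "w i \<otimes> f (y j \<ominus> y j') \<ominus> d (w i) \<otimes> (y j \<ominus> y j') \<in> WP"
        using fd wN[OF i] y by (simp add: parametrises_def)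
      then have "w i \<otimes> f (y j \<ominus> y j') \<in> WP \<longleftrightarrow> g j \<ominus> g j' \<in> WP"
        unfolding dy using wc[OF i] f(2)[of "y j \<ominus> y j'"] y g(1) by (intro WP_diff_mem_iff) auto
      then show ?thesis using g(2)[rule_format, OF that] by (simp add: f_diff)
    qed
    then show ?thesis using f(1)[OF y] by (intro exI[of _ "\<lambda>j. f (y j)"]) simp
  qed
  then obtain b :: "nat \<Rightarrow> nat \<Rightarrow> 'a" where b: "\<And>i j. i < n \<Longrightarrow> b i j \<in> S (B - {w i})"
      "\<And>i j j'. i < n \<Longrightarrow> j \<noteq> j' \<Longrightarrow> w i \<otimes> (b i j \<ominus> b i j') \<notin> WP" by metis
  have "w l \<noteq> w i" if "i < n" "l < n" "l \<noteq> i" for i l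
    using w that B(4) by (auto simp: bij_betw_def inj_on_def)
  then have "w l \<otimes> b i j \<in> WP" if "i < n" "l < n" "l \<noteq> i" for i l j
    using b(1)[OF that(1), of j] wB[OF that(2)] that by (auto simp: S_def)
  moreover have "b i j \<in> carrier R" if "i < n" for i j using b(1)[OF that] by (auto simp: S_def)
  ultimately show ?thesis using wc b(2) by blast
qed

text \<open>As in the Chinese remainder theorem, a path is realised by the sum of the chosen
  representatives, since each of them is invisible to the groups of all other rows. Two cosets in a
  row are disjoint because the difference of their conditions no longer involves
  \<open>x\<close>.\<close>

lemma coset_pattern:
  assumes "infinite (carrier R)"
    and "\<forall>j. g j \<in> carrier R" "\<forall>j j' :: nat. j \<noteq> j' \<longrightarrow> g j \<ominus> g j' \<notin> WP"
  shows "\<exists>w b. (\<forall>i<n :: nat. w i \<in> carrier R) \<and> (\<forall>i<n. \<forall>j :: nat. b i j \<in> carrier R) \<and>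
    (\<forall>i<n. \<forall>j j'. j \<noteq> j' \<longrightarrow>
       \<not> (\<exists>x \<in> carrier R. w i \<otimes> (x \<ominus> b i j) \<in> WP \<and> w i \<otimes> (x \<ominus> b i j') \<in> WP)) \<and>
    (\<forall>h. \<exists>x \<in> carrier R. \<forall>i<n. w i \<otimes> (x \<ominus> b i (h i)) \<in> WP)"
proof -
  obtain w and b :: "nat \<Rightarrow> nat \<Rightarrow> 'a" where w: "\<And>i. i < n \<Longrightarrow> w i \<in> carrier R" and b: "\<And>i j. i < n \<Longrightarrow> b i j \<in> carrier R"
    and off: "\<And>i l j. i < n \<Longrightarrow> l < n \<Longrightarrow> l \<noteq> i \<Longrightarrow> w l \<otimes> b i j \<in> WP"
    and diag: "\<And>i j j'. i < n \<Longrightarrow> j \<noteq> j' \<Longrightarrow> w i \<otimes> (b i j \<ominus> b i j') \<notin> WP"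
    using dual_families[OF assms, of n] by metis
  have "\<not> (\<exists>x \<in> carrier R. w i \<otimes> (x \<ominus> b i j) \<in> WP \<and> w i \<otimes> (x \<ominus> b i j') \<in> WP)"
    if "i < n" "j \<noteq> j'" for i j j'
  proof
    assume "\<exists>x \<in> carrier R. w i \<otimes> (x \<ominus> b i j) \<in> WP \<and> w i \<otimes> (x \<ominus> b i j') \<in> WP"
    then obtain x where x: "x \<in> carrier R" "w i \<otimes> (x \<ominus> b i j) \<in> WP" "w i \<otimes> (x \<ominus> b i j') \<in> WP"
      by blast
    have "w i \<otimes> (x \<ominus> b i j') \<ominus> w i \<otimes> (x \<ominus> b i j) = w i \<otimes> (b i j \<ominus> b i j')"
      using x(1) w[OF that(1)] b[OF that(1), of j] b[OF that(1), of j'] by algebra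
    then have "w i \<otimes> (b i j \<ominus> b i j') \<in> WP" using WP_diff[OF x(3,2)] by metis
    then show False using diag[OF that] by contradiction
  qed
  moreover have "\<exists>x \<in> carrier R. \<forall>i<n. w i \<otimes> (x \<ominus> b i (h i)) \<in> WP" for h
  proof -
    \<comment> \<open>The invariant also keeps \<open>x\<close> in the trivial coset for every row
      from \<open>k\<close> on; this is what lets the next representative be added.\<close>
    have "\<exists>x \<in> carrier R. \<forall>i<n. w i \<otimes> (x \<ominus> (if i < k then b i (h i) else \<zero>)) \<in> WP" if "k \<le> n" for k
      using that
    proof (induction k)
      case 0
      have "w i \<otimes> (\<zero> \<ominus> \<zero>) = \<zero>" if "i < n" for i
        using w[OF that] by (simp add: minus_eq)
      then show ?case using WP_zero by (intro bexI[of _ \<zero>]) auto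
    next
      case (Suc k)
      then obtain x where x: "x \<in> carrier R"
          "\<And>i. i < n \<Longrightarrow> w i \<otimes> (x \<ominus> (if i < k then b i (h i) else \<zero>)) \<in> WP" by auto
      have k: "k < n" using Suc.prems by simp
      have "w i \<otimes> ((x \<oplus> b k (h k)) \<ominus> (if i < Suc k then b i (h i) else \<zero>)) \<in> WP" if i: "i < n" for i
      proof (cases "i = k")
        case True
        have "(x \<oplus> b k (h k)) \<ominus> b k (h k) = x \<ominus> \<zero>" using x(1) b[OF k, of "h k"] by algebra
        then show ?thesis using x(2)[OF k] True by simp
      next
        case False
        define c where "c = (if i < k then b i (h i) else \<zero>)"
        have c: "c \<in> carrier R" using b i by (simp add: c_def)
        have "w i \<otimes> (x \<ominus> c) \<oplus> w i \<otimes> b k (h k) = w i \<otimes> ((x \<oplus> b k (h k)) \<ominus> c)"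
          using x(1) c w[OF i] b[OF k, of "h k"] by algebra
        moreover have "w i \<otimes> (x \<ominus> c) \<oplus> w i \<otimes> b k (h k) \<in> WP"
          using x(2)[OF i] off[OF k i False] unfolding c_def by (intro WP_add)
        ultimately have "w i \<otimes> ((x \<oplus> b k (h k)) \<ominus> c) \<in> WP" by metis
        moreover have "(if i < Suc k then b i (h i) else \<zero>) = c" using False by (simp add: c_def)
        ultimately show ?thesis by simp
      qed
      then show ?case using x(1) b[OF k] by (intro bexI[of _ "x \<oplus> b k (h k)"]) auto
    qed
    from this[of n] show ?thesis by auto
  qed
  ultimately show ?thesis using w b by (intro exI[of _ w] exI[of _ b] conjI allI impI)
qed

end

section \<open>Artin--Schreier extensions and cosets\<close>

context char_p_field
begin

lemma generate_field_eq_if_diff_mem: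
  assumes k: "subfield k R" and a: "a \<in> carrier R" "b \<in> carrier R" and ab: "a \<ominus> b \<in> k"
  shows "generate_field R (insert a k) = generate_field R (insert b k)"
proof -
  have kR: "k \<subseteq> carrier R" using subfieldE(3)[OF k] .
  have sub: "generate_field R (insert x k) \<subseteq> generate_field R (insert y k)"
    if "x \<in> carrier R" "y \<in> carrier R" "x \<ominus> y \<in> k" for x y
  proof (rule generate_field_min_subfield1)
    show "subfield (generate_field R (insert y k)) R"
      using that kR by (intro generate_field_is_subfield) auto
    have "(x \<ominus> y) \<oplus> y \<in> generate_field R (insert y k)"
      using that(3) by (intro generate_field.eng_add) (auto intro: generate_field.incl)
    moreover have "(x \<ominus> y) \<oplus> y = x" using that(1,2) by algebra
    ultimately show "insert x k \<subseteq> generate_field R (insert y k)"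
      by (auto intro: generate_field.incl)
  qed (use that kR in auto)
  have "\<ominus> (a \<ominus> b) \<in> k" using ab subringE(5)[OF subfieldE(1)[OF k]] by blast
  moreover have "\<ominus> (a \<ominus> b) = b \<ominus> a" using a by algebra
  ultimately have "b \<ominus> a \<in> k" by metis
  with sub a ab show ?thesis by blast
qed

text \<open>The zeros of \<open>wp\<close> form the prime field, which lies in every
  subfield.\<close>

lemma wp_eq_zero_in_subfield:
  assumes k: "subfield k R" and z: "z \<in> carrier R" "wp z = \<zero>"
  shows "z \<in> k"
proof -
  have "z [^] p = z" using z by (simp add: wp_def r_right_minus_eq)
  then obtain n :: nat where n: "z = [n] \<cdot> \<one>" using z(1) frob_fixed_eq by blast
  have "[n] \<cdot> \<one> \<in> k" for n :: nat
  proof (induction n)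
    case 0
    then show ?case using subringE(2)[OF subfieldE(1)[OF k]] by simp
  next
    case (Suc n)
    then show ?case using subringE(3,7)[OF subfieldE(1)[OF k]] by simp
  qed
  then show ?thesis by (simp add: n)
qed

text \<open>\<open>wp\<close> is additive and kills a - b - y, so a - b differs from
  \<open>y\<close> by an element of the prime field.\<close>

lemma artin_schreier_eq_if_same_coset:
  assumes k: "subfield k R" and a: "a \<in> carrier R" "b \<in> carrier R"
    and y: "y \<in> k" "wp a \<ominus> wp b = wp y"
  shows "generate_field R (insert a k) = generate_field R (insert b k)"
proof (rule generate_field_eq_if_diff_mem[OF k a])
  have yR: "y \<in> carrier R" using y subfieldE(3)[OF k] by blast
  have "wp ((a \<ominus> b) \<ominus> y) = (wp a \<ominus> wp b) \<ominus> wp y"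
    using a yR by (simp add: minus_eq wp_add wp_minus)
  also have "\<dots> = \<zero>" using y(2) yR by (simp add: r_right_minus_eq)
  finally have "(a \<ominus> b) \<ominus> y \<in> k" using a yR by (intro wp_eq_zero_in_subfield[OF k]) auto
  then have "((a \<ominus> b) \<ominus> y) \<oplus> y \<in> k" using y(1) subringE(7)[OF subfieldE(1)[OF k]] by blast
  moreover have "((a \<ominus> b) \<ominus> y) \<oplus> y = a \<ominus> b" using a yR by algebra
  ultimately show "a \<ominus> b \<in> k" by metis
qed

text \<open>Congruence is taken modulo the image of \<open>k\<close> rather than \<open>WP\<close>:
  in an algebraically closed \<open>R\<close> the latter is everything.\<close>

lemma incongruent_sequence_if_infinite_artin_schreier:
  assumes "infinite {F. artin_schreier_extension p R k F}"
  shows "\<exists>g :: nat \<Rightarrow> 'a. (\<forall>j. g j \<in> k) \<and> (\<forall>j j'. j \<noteq> j' \<longrightarrow> g j \<ominus> g j' \<notin> wp ` k)"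
proof -
  obtain F :: "nat \<Rightarrow> 'a set" where F: "inj F" "range F \<subseteq> {F. artin_schreier_extension p R k F}"
    using infinite_countable_subset[OF assms] by blast
  then have ext: "artin_schreier_extension p R k (F j)" for j by auto
  then have k: "subfield k R" by (auto simp: artin_schreier_extension_def)
  have "\<exists>a. a \<in> carrier R \<and> wp a \<in> k \<and> F j = generate_field R (insert a k)" for j
  proof -
    obtain a where "a \<in> F j" "subfield (F j) R" "wp a \<in> k" "F j = generate_field R (insert a k)"
      using ext[of j] by (auto simp: artin_schreier_extension_def wp_def)
    then show ?thesis using subfieldE(3) by blast
  qed
  then obtain a where a: "\<And>j. a j \<in> carrier R" "\<And>j. wp (a j) \<in> k"
      "\<And>j. F j = generate_field R (insert (a j) k)" by metis
  have "wp (a j) \<ominus> wp (a j') \<notin> wp ` k" if "j \<noteq> j'" for j j'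
  proof
    assume "wp (a j) \<ominus> wp (a j') \<in> wp ` k"
    then obtain y where "y \<in> k" "wp (a j) \<ominus> wp (a j') = wp y" by blast
    then have "F j = F j'" using artin_schreier_eq_if_same_coset[OF k a(1) a(1)] a(3) by metis
    with F(1) that show False by (auto simp: inj_def)
  qed
  then show ?thesis using a(2) by (intro exI[of _ "\<lambda>j. wp (a j)"]) simp
qed

end

text \<open>A homomorphism of fields is injective, so the same multiples of one vanish on both
  sides.\<close>

lemma has_characteristic_hom:
  assumes K: "field K" and \<Omega>: "field \<Omega>" and h: "h \<in> ring_hom K \<Omega>" and char: "has_characteristic K p"
  shows "has_characteristic \<Omega> p"
proof -
  interpret K: field K by fact
  interpret \<Omega>: field \<Omega> by fact
  interpret h: ring_hom_cring K \<Omega> h using h by unfold_locales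
  have "h ([n] \<cdot>\<^bsub>K\<^esub> \<one>\<^bsub>K\<^esub>) = [n] \<cdot>\<^bsub>\<Omega>\<^esub> \<one>\<^bsub>\<Omega>\<^esub>" for n :: nat
    by (induction n) auto
  moreover have "h x = \<zero>\<^bsub>\<Omega>\<^esub> \<longleftrightarrow> x = \<zero>\<^bsub>K\<^esub>" if "x \<in> carrier K" for x
  proof
    assume hx: "h x = \<zero>\<^bsub>\<Omega>\<^esub>"
    show "x = \<zero>\<^bsub>K\<^esub>"
    proof (rule ccontr)
      assume "x \<noteq> \<zero>\<^bsub>K\<^esub>"
      then have u: "x \<in> Units K" using that by (simp add: K.field_Units)
      then have "h (x \<otimes>\<^bsub>K\<^esub> inv\<^bsub>K\<^esub> x) = \<one>\<^bsub>\<Omega>\<^esub>" by simp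
      moreover have "h (x \<otimes>\<^bsub>K\<^esub> inv\<^bsub>K\<^esub> x) = h x \<otimes>\<^bsub>\<Omega>\<^esub> h (inv\<^bsub>K\<^esub> x)" using u that by (intro h.hom_mult) auto
      ultimately show False using hx u by simp
    qed
  qed simp
  ultimately show ?thesis
    using char unfolding has_characteristic_def by (metis K.add.nat_pow_closed K.one_closed)
qed

section \<open>Definability of the cosets\<close>

locale definable_char_p_field = definability L M d + char_p_field K p
  for L :: "('f, 'r) lang" and M :: "('f, 'r, 'm) struct" and d and K :: "'m list ring" (structure) and p +
  assumes definable: "definable_field L M d K"
begin

lemma carrier_tuples: "x \<in> carrier K \<Longrightarrow> x \<in> tuples M d"
  using definable by (auto simp: definable_field_def definable_set_def)

text \<open>All elements of K have length \<open>d\<close>, so a concatenation can be split back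
  into its three tuples uniquely.\<close>

lemma definable_rel_graph:
  assumes S: "definable_set L M (3 * d) {x @ y @ q x y | x y. x \<in> carrier K \<and> y \<in> carrier K}"
    and q: "\<And>x y. x \<in> carrier K \<Longrightarrow> y \<in> carrier K \<Longrightarrow> q x y \<in> carrier K"
  shows "definable_rel 3 (\<lambda>bs. bs ! 0 \<in> carrier K \<and> bs ! 1 \<in> carrier K \<and> bs ! 2 = q (bs ! 0) (bs ! 1))"
proof (rule definable_rel_cong[OF definable_rel_of_set[OF S]])
  fix bs assume bs: "length bs = 3" "set bs \<subseteq> tuples M d"
  then obtain a b c where abc: "bs = [a, b, c]" by (auto simp: numeral_3_eq_3 length_Suc_conv)
  have len: "length a = d" "length b = d" "length c = d" using bs(2) by (auto simp: abc tuples_def)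
  have lenK: "length x = d" if "x \<in> carrier K" for x using carrier_tuples[OF that] by (simp add: tuples_def)
  have "a @ b @ c = x @ y @ q x y \<longleftrightarrow> a = x \<and> b = y \<and> c = q x y"
    if "x \<in> carrier K" "y \<in> carrier K" for x y
    using len lenK[OF that(1)] lenK[OF that(2)] by simp
  then show "bs ! 0 \<in> carrier K \<and> bs ! 1 \<in> carrier K \<and> bs ! 2 = q (bs ! 0) (bs ! 1) \<longleftrightarrow>
      concat bs \<in> {x @ y @ q x y | x y. x \<in> carrier K \<and> y \<in> carrier K}"
    by (auto simp: abc)
qed

section \<open>Definability of the field operations, of x^p - x and of the cosets\<close>

definition Add :: "'m list list \<Rightarrow> bool" where
  "Add bs \<longleftrightarrow> bs ! 0 \<in> carrier K \<and> bs ! 1 \<in> carrier K \<and> bs ! 2 = bs ! 0 \<oplus> bs ! 1"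

definition Mult :: "'m list list \<Rightarrow> bool" where
  "Mult bs \<longleftrightarrow> bs ! 0 \<in> carrier K \<and> bs ! 1 \<in> carrier K \<and> bs ! 2 = bs ! 0 \<otimes> bs ! 1"

lemma definable_Add: "definable_rel 3 Add"
  unfolding Add_def using definable by (intro definable_rel_graph) (auto simp: definable_field_def)

lemma definable_Mult: "definable_rel 3 Mult"
  unfolding Mult_def using definable by (intro definable_rel_graph) (auto simp: definable_field_def)

text \<open>Counting from the square makes the base case an instance of \<open>Mult\<close>, and p
  \<ge> 2 ensures that the p-th power is reached.\<close>

lemma definable_power:
  "definable_rel 2 (\<lambda>bs. bs ! 0 \<in> carrier K \<and> bs ! 1 = bs ! 0 [^] Suc (Suc n))"
proof (induction n)
  case 0
  have "definable_rel 2 (\<lambda>bs. Mult (map ((!) bs) [0, 0, 1]))"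
    by (rule definable_rel_pullback[OF definable_Mult]) auto
  then show ?case by (rule definable_rel_cong) (auto simp: Mult_def)
next
  case (Suc n)
  let ?P = "\<lambda>bs. bs ! 0 \<in> carrier K \<and> bs ! 1 = bs ! 0 [^] Suc (Suc n)"
  have "definable_rel (Suc 2) (\<lambda>bs. ?P (map ((!) bs) [0, 2]) \<and> Mult (map ((!) bs) [2, 0, 1]))"
    by (intro definable_rel_conj definable_rel_pullback[OF Suc] definable_rel_pullback[OF definable_Mult])
      auto
  then have "definable_rel 2 (\<lambda>bs. \<exists>b \<in> tuples M d.
      ?P (map ((!) (bs @ [b])) [0, 2]) \<and> Mult (map ((!) (bs @ [b])) [2, 0, 1]))"
    by (rule definable_rel_ex)
  then show ?case
    by (rule definable_rel_cong)
      (auto simp: Mult_def nth_append numeral_2_eq_2 simp del: nat_pow_Suc intro!: carrier_tuples)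
qed

lemma definable_wp: "definable_rel 2 (\<lambda>bs. bs ! 0 \<in> carrier K \<and> bs ! 1 = wp (bs ! 0))"
proof -
  let ?P = "\<lambda>bs. bs ! 0 \<in> carrier K \<and> bs ! 1 = bs ! 0 [^] p"
  have p: "p = Suc (Suc (p - 2))" using p_gt_1 by simp
  have P: "definable_rel 2 ?P" using definable_power[of "p - 2"] p by metis
  \<comment> \<open>Position 2 holds the p-th power of position 0. The difference y = x^p - x is
    expressed through addition, as y + x = x^p.\<close>
  have "definable_rel (Suc 2) (\<lambda>bs. ?P (map ((!) bs) [0, 2]) \<and> Add (map ((!) bs) [1, 0, 2]))"
    by (intro definable_rel_conj definable_rel_pullback[OF P] definable_rel_pullback[OF definable_Add])
      auto
  then have "definable_rel 2 (\<lambda>bs. \<exists>b \<in> tuples M d.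
      ?P (map ((!) (bs @ [b])) [0, 2]) \<and> Add (map ((!) (bs @ [b])) [1, 0, 2]))"
    by (rule definable_rel_ex)
  then show ?thesis
  proof (rule definable_rel_cong)
    fix bs assume "length bs = 2" "set bs \<subseteq> tuples M d"
    then obtain x y where xy: "bs = [x, y]" by (auto simp: numeral_2_eq_2 length_Suc_conv)
    have "y = wp x \<longleftrightarrow> y \<in> carrier K \<and> x [^] p = y \<oplus> x" if "x \<in> carrier K"
    proof
      assume y: "y = wp x"
      have "(x [^] p \<ominus> x) \<oplus> x = x [^] p" using that nat_pow_closed[OF that, of p] by algebra
      then show "y \<in> carrier K \<and> x [^] p = y \<oplus> x" using that by (simp add: y wp_def)
    next
      assume y: "y \<in> carrier K \<and> x [^] p = y \<oplus> x"
      then have "(y \<oplus> x) \<ominus> x = y" using that by algebra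
      then show "y = wp x" using y by (simp add: wp_def)
    qed
    then show "bs ! 0 \<in> carrier K \<and> bs ! 1 = wp (bs ! 0) \<longleftrightarrow> (\<exists>b \<in> tuples M d.
      ?P (map ((!) (bs @ [b])) [0, 2]) \<and> Add (map ((!) (bs @ [b])) [1, 0, 2]))"
      by (auto simp: xy Add_def intro!: carrier_tuples)
  qed
qed

lemma definable_coset:
  "definable_rel 3 (\<lambda>bs. bs ! 0 \<in> carrier K \<and> bs ! 1 \<in> carrier K \<and> bs ! 2 \<in> carrier K \<and>
     bs ! 1 \<otimes> (bs ! 0 \<ominus> bs ! 2) \<in> WP)"
proof -
  let ?W = "\<lambda>bs. bs ! 0 \<in> carrier K \<and> bs ! 1 = wp (bs ! 0)"
  \<comment> \<open>Positions 0, 1, 2 hold \<open>x\<close>, \<open>w\<close>, \<open>b\<close>; the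
    auxiliary positions 3, 4, 5 hold the difference of \<open>x\<close> and \<open>b\<close>, its
    product with \<open>w\<close>, and a preimage of that product under \<open>wp\<close>.\<close>
  define Q where "Q bs \<longleftrightarrow> Add (map ((!) bs) [3, 2, 0]) \<and> Mult (map ((!) bs) [1, 3, 4]) \<and>
      ?W (map ((!) bs) [5, 4])" for bs
  have "definable_rel 6 Q"
    unfolding Q_def
    by (intro definable_rel_conj definable_rel_pullback[OF definable_Add]
        definable_rel_pullback[OF definable_Mult] definable_rel_pullback[OF definable_wp]) auto
  then have "definable_rel (Suc (Suc (Suc 3))) Q" by (simp add: eval_nat_numeral)
  then have "definable_rel 3 (\<lambda>bs. \<exists>c \<in> tuples M d. \<exists>z \<in> tuples M d. \<exists>y \<in> tuples M d.
      Q (((bs @ [c]) @ [z]) @ [y]))"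
    by (intro definable_rel_ex)
  then show ?thesis
  proof (rule definable_rel_cong)
    fix bs assume "length bs = 3" "set bs \<subseteq> tuples M d"
    then obtain x w b where bs: "bs = [x, w, b]" by (auto simp: numeral_3_eq_3 length_Suc_conv)
    have Q: "Q (((bs @ [c]) @ [z]) @ [y]) \<longleftrightarrow> (c \<in> carrier K \<and> b \<in> carrier K \<and> x = c \<oplus> b) \<and>
        (w \<in> carrier K \<and> c \<in> carrier K \<and> z = w \<otimes> c) \<and> (y \<in> carrier K \<and> z = wp y)" for c z y
      by (simp add: Q_def bs Add_def Mult_def)
    have "(\<exists>c \<in> tuples M d. \<exists>z \<in> tuples M d. \<exists>y \<in> tuples M d. Q (((bs @ [c]) @ [z]) @ [y])) \<longleftrightarrow>
        x \<in> carrier K \<and> w \<in> carrier K \<and> b \<in> carrier K \<and> w \<otimes> (x \<ominus> b) \<in> WP"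
    proof
      assume "\<exists>c \<in> tuples M d. \<exists>z \<in> tuples M d. \<exists>y \<in> tuples M d. Q (((bs @ [c]) @ [z]) @ [y])"
      then obtain c y where *: "c \<in> carrier K" "b \<in> carrier K" "x = c \<oplus> b" "w \<in> carrier K"
          "w \<otimes> c = wp y" "y \<in> carrier K"
        unfolding Q by metis
      have "(c \<oplus> b) \<ominus> b = c" using *(1,2) by algebra
      then show "x \<in> carrier K \<and> w \<in> carrier K \<and> b \<in> carrier K \<and> w \<otimes> (x \<ominus> b) \<in> WP"
        using * by simp
    next
      assume *: "x \<in> carrier K \<and> w \<in> carrier K \<and> b \<in> carrier K \<and> w \<otimes> (x \<ominus> b) \<in> WP"
      then obtain y where y: "y \<in> carrier K" "w \<otimes> (x \<ominus> b) = wp y" by (auto simp: WP_def)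
      have "x = (x \<ominus> b) \<oplus> b" using * by algebra
      then have "Q (((bs @ [x \<ominus> b]) @ [w \<otimes> (x \<ominus> b)]) @ [y])"
        unfolding Q using * y by simp
      then show "\<exists>c \<in> tuples M d. \<exists>z \<in> tuples M d. \<exists>y \<in> tuples M d. Q (((bs @ [c]) @ [z]) @ [y])"
        using * y(1) by (blast intro: carrier_tuples minus_closed m_closed)
    qed
    then show "bs ! 0 \<in> carrier K \<and> bs ! 1 \<in> carrier K \<and> bs ! 2 \<in> carrier K \<and>
        bs ! 1 \<otimes> (bs ! 0 \<ominus> bs ! 2) \<in> WP \<longleftrightarrow>
      (\<exists>c \<in> tuples M d. \<exists>z \<in> tuples M d. \<exists>y \<in> tuples M d. Q (((bs @ [c]) @ [z]) @ [y]))"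
      by (simp add: bs numeral_2_eq_2)
  qed
qed

lemma has_TP2_if_incongruent_sequence:
  assumes M: "is_struct L M" and inf: "infinite (carrier K)"
    and g: "\<forall>j. g j \<in> carrier K" "\<forall>j j' :: nat. j \<noteq> j' \<longrightarrow> g j \<ominus> g j' \<notin> WP"
  shows "\<exists>\<phi> m n. wf_fm L \<phi> \<and> fv \<phi> \<subseteq> {..<m + n} \<and> has_TP2 L (complete_theory L M) \<phi> m n"
proof -
  obtain \<phi> cs where \<phi>: "wf_fm L \<phi>" "set cs \<subseteq> univ M" "fv \<phi> \<subseteq> {..<3 * d + length cs}"
    and sat: "\<And>bs. length bs = 3 \<Longrightarrow> set bs \<subseteq> tuples M d \<Longrightarrow>
      (bs ! 0 \<in> carrier K \<and> bs ! 1 \<in> carrier K \<and> bs ! 2 \<in> carrier K \<and>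
        bs ! 1 \<otimes> (bs ! 0 \<ominus> bs ! 2) \<in> WP) \<longleftrightarrow> sat_tup M \<phi> (concat bs @ cs)"
    using definable_coset unfolding definable_rel_def by blast
  have sat: "sat_tup M \<phi> (x @ w @ b @ cs) \<longleftrightarrow> x \<in> carrier K \<and> w \<otimes> (x \<ominus> b) \<in> WP"
    if "x \<in> tuples M d" "w \<in> carrier K" "b \<in> carrier K" for x w b
    using sat[of "[x, w, b]"] that by (simp add: carrier_tuples)
  define n where "n = d + d + length cs"
  have fv: "fv \<phi> \<subseteq> {..<d + n}" using \<phi>(3) by (auto simp: n_def)
  have param: "w @ b @ cs \<in> tuples M n" if "w \<in> carrier K" "b \<in> carrier K" for w b
    using carrier_tuples[OF that(1)] carrier_tuples[OF that(2)] \<phi>(2) by (auto simp: tuples_def n_def)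
  have "has_TP2 L (complete_theory L M) \<phi> d n"
  proof (rule has_TP2_if_finite_patterns[OF M \<phi>(1) fv])
    fix N :: nat
    from coset_pattern[OF inf g, of N] obtain w and b :: "nat \<Rightarrow> nat \<Rightarrow> 'm list" where
      w: "\<forall>i<N. w i \<in> carrier K" and b: "\<forall>i<N. \<forall>j. b i j \<in> carrier K" and
      row: "\<forall>i<N. \<forall>j j'. j \<noteq> j' \<longrightarrow>
        \<not> (\<exists>x \<in> carrier K. w i \<otimes> (x \<ominus> b i j) \<in> WP \<and> w i \<otimes> (x \<ominus> b i j') \<in> WP)" and
      path: "\<forall>h. \<exists>x \<in> carrier K. \<forall>i<N. w i \<otimes> (x \<ominus> b i (h i)) \<in> WP"
      by (elim exE conjE) (rule that)
    \<comment> \<open>Rows from \<open>N\<close> on carry no condition but must still consist of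
      tuples of the right length, hence the zero entries.\<close>
    define a where "a i j = (if i < N then w i @ b i j @ cs else \<zero> @ \<zero> @ cs)" for i j
    have "a i j \<in> tuples M n" for i j using w b by (simp add: a_def param)
    moreover have "\<not> (\<exists>x \<in> tuples M d. sat_tup M \<phi> (x @ a i j) \<and> sat_tup M \<phi> (x @ a i j'))"
      if "i < N" "j \<noteq> j'" for i j j'
    proof -
      have "sat_tup M \<phi> (x @ a i j) \<longleftrightarrow> x \<in> carrier K \<and> w i \<otimes> (x \<ominus> b i j) \<in> WP"
        if "x \<in> tuples M d" for x j
        using sat[OF that] w b \<open>i < N\<close> by (simp add: a_def)
      with row that show ?thesis by blast
    qed
    moreover have "\<exists>x \<in> tuples M d. \<forall>i<N. sat_tup M \<phi> (x @ a i (h i))" for h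
    proof -
      obtain x where x: "x \<in> carrier K" "\<And>i. i < N \<Longrightarrow> w i \<otimes> (x \<ominus> b i (h i)) \<in> WP"
        using path by blast
      then have "\<forall>i<N. sat_tup M \<phi> (x @ a i (h i))"
        using sat[OF carrier_tuples[OF x(1)]] w b by (simp add: a_def)
      then show ?thesis using carrier_tuples[OF x(1)] by blast
    qed
    ultimately show "\<exists>a :: nat \<Rightarrow> nat \<Rightarrow> 'm list. (\<forall>i j. a i j \<in> tuples M n) \<and>
      (\<forall>i<N. \<forall>j j'. j \<noteq> j' \<longrightarrow>
         \<not> (\<exists>b \<in> tuples M d. sat_tup M \<phi> (b @ a i j) \<and> sat_tup M \<phi> (b @ a i j'))) \<and>
      (\<forall>f. \<exists>b \<in> tuples M d. \<forall>i<N. sat_tup M \<phi> (b @ a i (f i)))"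
      by blast
  qed
  with \<phi>(1) fv show ?thesis by blast
qed

end

theorem theorem3p1:
  fixes L :: "('f, 'r) lang"
    and M :: "('f, 'r, 'm) struct"
    and K :: "'m list ring"
    and \<Omega> :: "('o, 'w) ring_scheme"
    and h :: "'m list \<Rightarrow> 'o"
    and d p :: nat
  assumes "is_struct L M"
    and "NTP2 L (complete_theory L M)"
    and "definable_field L M d K"
    and "infinite (carrier K)"
    and "p > 0"
    and "has_characteristic K p"
    and "h \<in> ring_hom K \<Omega>"
    and "algebraic_closure \<Omega> (h ` carrier K)"
  shows "finite {F. artin_schreier_extension p \<Omega> (h ` carrier K) F}"
proof (rule ccontr)
  assume inf: "infinite {F. artin_schreier_extension p \<Omega> (h ` carrier K) F}"
  have K: "field K" using assms(3) by (simp add: definable_field_def)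
  have \<Omega>: "field \<Omega>" using assms(8) by (rule algebraic_closure.axioms(1))
  interpret K: definable_char_p_field L M d K p
    using K assms(3,5,6) by (intro definable_char_p_field.intro char_p_field.intro)
      (simp_all add: char_p_field_axioms_def definable_char_p_field_axioms_def)
  interpret \<Omega>: char_p_field \<Omega> p
    using \<Omega> assms(5) has_characteristic_hom[OF K \<Omega> assms(7,6)]
    by (intro char_p_field.intro) (simp_all add: char_p_field_axioms_def)
  interpret h: ring_hom_cring K \<Omega> h using assms(7) by unfold_locales
  obtain g where g: "\<And>j. g j \<in> h ` carrier K"
      "\<And>j j' :: nat. j \<noteq> j' \<Longrightarrow> g j \<ominus>\<^bsub>\<Omega>\<^esub> g j' \<notin> \<Omega>.wp ` h ` carrier K"
    using \<Omega>.incongruent_sequence_if_infinite_artin_schreier[OF inf] by blast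
  have "\<forall>j. \<exists>c \<in> carrier K. g j = h c" using g(1) by auto
  then obtain c where c: "\<And>j. c j \<in> carrier K" "\<And>j. g j = h (c j)" by metis
  \<comment> \<open>\<open>h\<close> commutes with \<open>wp\<close>, so a congruence in K would
    carry over to its image and contradict the choice of \<open>g\<close>.\<close>
  have "c j \<ominus>\<^bsub>K\<^esub> c j' \<notin> K.WP" if "j \<noteq> j'" for j j'
  proof
    assume "c j \<ominus>\<^bsub>K\<^esub> c j' \<in> K.WP"
    then obtain y where y: "y \<in> carrier K" "c j \<ominus>\<^bsub>K\<^esub> c j' = K.wp y" by (auto simp: K.WP_def)
    have "g j \<ominus>\<^bsub>\<Omega>\<^esub> g j' = h (c j \<ominus>\<^bsub>K\<^esub> c j')"
      using c by (simp add: K.minus_eq \<Omega>.minus_eq)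
    also have "\<dots> = \<Omega>.wp (h y)"
      unfolding y(2) using y(1) by (simp add: K.wp_def \<Omega>.wp_def K.minus_eq \<Omega>.minus_eq)
    finally show False using g(2)[OF that] y(1) by blast
  qed
  then obtain \<phi> m n where "wf_fm L \<phi>" "fv \<phi> \<subseteq> {..<m + n}" "has_TP2 L (complete_theory L M) \<phi> m n"
    using K.has_TP2_if_incongruent_sequence[OF assms(1,4), of c] c(1) by blast
  then show False using assms(2) unfolding NTP2_def by blast
qed

end
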